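(* Let $(K,\overline p)$ be a perverse full filtered simplicial complex. The inclusion maps induce an isomorphism of chain complexes $$\bigoplus_{\beta\in\mathcal B(K)}C^{\overline p}_*(\beta*L_\beta,\ \partial\beta*L_\beta)\xrightarrow{\ \cong\ }C_*^{\overline p}(K,\mathcal L(K)).$$
   Context: Coefficients are in a fixed abelian group $\mathsf R$. A simplicial complex $K$ is a set of simplices in $\mathbb R^p$, $p\le\infty$, such that two intersecting simplices meet in a common face, faces of simplices of $K$ are in $K$, and every vertex belongs to finitely many simplices of $K$. $|K|$ is the union of the simplices. A filtered simplicial complex is a simplicial complex with a filtration by subcomplexes $K=K_n\supset K_{n-1}\supset\dots\supset K_0\supset K_{-1}=\emptyset$. It is full if each $K_\ell$ is a full subcomplex (any simplex of $K$ with all its vertices in $K_\ell$ is in $K_\ell$). A stratum is a non-empty connected component $S$ of some $|K_i|\setminus|K_{i-1}|$; $\dim_v S=i$, $\operatorname{codim}_v S=n-i$; $S$ is regular if $i=n$ and singular otherwise. A perversity is a map $\overline p$ from the set of strata to $\mathbb Z\cup\{\pm\infty\}$ with value $0$ on regular strata; $(K,\overline p)$ is a perverse filtered simplicial complex. A subcomplex $L\subset K$ carries the induced filtration $L_i=L\cap K_i$; each stratum $T$ of $L$ lies in a unique stratum $S$ of $K$, and the induced perversity, still denoted $\overline p$, is $\overline p(T)=\overline p(S)$. Complexity and clots: for $K\ne\emptyset$, $\operatorname{comp}(K)=(a,b)$ with $a=\max\{k\in\{0,\dots,n\}\mid K_{n-k}\neq\emptyset\}$ and $b\in\mathbb N\cup\{\infty\}$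 the dimension of the simplicial complex $K_{n-a}$. A clot is a simplex $\beta$ of $K_{n-a}$ with $\dim\beta=b$; $\mathcal B(K)$ is the set of clots. The link of $\beta$ is $L_\beta=\{\sigma\in K\mid\beta*\sigma\in K\}$, $*$ denoting the join (so $\sigma$ is disjoint from $\beta$); $\beta*L_\beta$ is the join subcomplex, $\partial\beta$ the boundary complex of $\beta$ (empty if $\dim\beta=0$), and $\emptyset*E=E$. The residual complex is $\mathcal L(K)=\{\sigma\in K\mid\dim(\sigma\cap|K_{n-a}|)<b\}$ (with $\dim\emptyset=-\infty$). One has $\partial\beta*L_\beta\subset\mathcal L(K)$ for each clot $\beta$. Intersection chains: $C_*(K)$ is the complex of oriented simplicial chains. A simplex $\sigma$ is $\overline p$-allowable if $\dim(\sigma\cap S)\le\dim\sigma-\operatorname{codim}_v S+\overline p(S)$ for each stratum $S$. $C^{\overline p}_*(K)$ is the complex of chains $c$ such that all simplices with non-zero coefficient in $c$ and in $\partial c$ are $\overline p$-allowable. For a subcomplex $L\subset K$, $C^{\overline p}_*(K,L)=C^{\overline p}_*(K)/C^{\overline p}_*(L)$. *)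

theory Defs
  imports
    "HOL-Analysis.Analysis"
    "HOL-Analysis.Finite_Function_Topology"
    "HOL-Algebra.Free_Abelian_Groups"
    "HOL-Combinatorics.Permutations"
begin

section \<open>Geometric simplicial complexes\<close>

text \<open>
  The ambient space is an arbitrary real normed vector space. The type \<^typ>\<open>real ^ 'p\<close> gives
  \<open>\<real>\<^sup>p\<close> for finite \<open>p\<close>, and the finitely supported sequences
  (\<open>nat \<Rightarrow>\<^sub>0 real\<close>, normed in \<^theory>\<open>HOL-Analysis.Finite_Function_Topology\<close>) give \<open>\<real>\<^sup>\<infinity>\<close>.
  Simplices are closed, non-empty point sets.
\<close>

definition geom_simplex :: "'v::real_vector set \<Rightarrow> bool" where
  "geom_simplex \<sigma> \<longleftrightarrow>
     (\<exists>C. finite C \<and> C \<noteq> {} \<and> \<not> affine_dependent C \<and> \<sigma> = convex hull C)"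

definition verts :: "'v::real_vector set \<Rightarrow> 'v set" where
  "verts \<sigma> = {v. v extreme_point_of \<sigma>}"

definition sdim :: "'v::real_vector set \<Rightarrow> nat" where
  "sdim \<sigma> = card (verts \<sigma>) - 1"

text \<open>
  The dimension of a point set, needed for sets such as \<open>\<sigma> \<inter> S\<close> with \<open>S\<close> a stratum, which are
  unions of relatively open faces of \<open>\<sigma>\<close> but in general not simplices: the largest dimension of
  a simplex contained in the set. As a supremum in \<^typ>\<open>ereal\<close> it is \<open>-\<infinity>\<close> for the empty set.
\<close>

definition dimension :: "'v::real_vector set \<Rightarrow> ereal" where
  "dimension A = (SUP \<tau>\<in>{\<tau>. geom_simplex \<tau> \<and> \<tau> \<subseteq> A}. ereal (real (sdim \<tau>)))"

definition geom_complex :: "'v::real_vector set set \<Rightarrow> bool" where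
  "geom_complex K \<longleftrightarrow>
     (\<forall>\<sigma>\<in>K. geom_simplex \<sigma>) \<and>
     (\<forall>\<sigma>\<in>K. \<forall>\<tau>. \<tau> face_of \<sigma> \<and> \<tau> \<noteq> {} \<longrightarrow> \<tau> \<in> K) \<and>
     (\<forall>\<sigma>\<in>K. \<forall>\<tau>\<in>K. \<sigma> \<inter> \<tau> \<noteq> {} \<longrightarrow> (\<sigma> \<inter> \<tau>) face_of \<sigma> \<and> (\<sigma> \<inter> \<tau>) face_of \<tau>) \<and>
     (\<forall>v. {v} \<in> K \<longrightarrow> finite {\<sigma>\<in>K. v \<in> \<sigma>})"

definition subcomplex :: "'v::real_vector set set \<Rightarrow> 'v set set \<Rightarrow> bool" where
  "subcomplex L K \<longleftrightarrow> L \<subseteq> K \<and> (\<forall>\<sigma>\<in>L. \<forall>\<tau>. \<tau> face_of \<sigma> \<and> \<tau> \<noteq> {} \<longrightarrow> \<tau> \<in> L)"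

definition complex_dim :: "'v::real_vector set set \<Rightarrow> ereal" where
  "complex_dim K = (SUP \<sigma>\<in>K. ereal (real (sdim \<sigma>)))"

text \<open>
  \<open>|K| = \<Union>K\<close> carries the usual topology of a simplicial complex, coherent with its simplices.
\<close>

definition realization :: "'v::topological_space set set \<Rightarrow> 'v topology" where
  "realization K =
     topology (\<lambda>U. U \<subseteq> \<Union>K \<and> (\<forall>\<sigma>\<in>K. openin (top_of_set \<sigma>) (\<sigma> \<inter> U)))"

lemma openin_realization:
  "openin (realization K) U \<longleftrightarrow>
     U \<subseteq> \<Union>K \<and> (\<forall>\<sigma>\<in>K. openin (top_of_set \<sigma>) (\<sigma> \<inter> U))"
proof -
  have "istopology (\<lambda>U. U \<subseteq> \<Union>K \<and> (\<forall>\<sigma>\<in>K. openin (top_of_set \<sigma>) (\<sigma> \<inter> U)))"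
    unfolding istopology_def
  proof (intro conjI allI impI ballI)
    fix S T \<sigma>
    assume S: "S \<subseteq> \<Union>K \<and> (\<forall>\<sigma>\<in>K. openin (top_of_set \<sigma>) (\<sigma> \<inter> S))"
      and T: "T \<subseteq> \<Union>K \<and> (\<forall>\<sigma>\<in>K. openin (top_of_set \<sigma>) (\<sigma> \<inter> T))"
    then show "S \<inter> T \<subseteq> \<Union>K" by blast
    assume "\<sigma> \<in> K"
    then have "openin (top_of_set \<sigma>) ((\<sigma> \<inter> S) \<inter> (\<sigma> \<inter> T))"
      using S T by (metis openin_Int)
    moreover have "(\<sigma> \<inter> S) \<inter> (\<sigma> \<inter> T) = \<sigma> \<inter> (S \<inter> T)" by blast
    ultimately show "openin (top_of_set \<sigma>) (\<sigma> \<inter> (S \<inter> T))" by metis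
  next
    fix \<U>
    assume U: "\<forall>U\<in>\<U>. U \<subseteq> \<Union>K \<and> (\<forall>\<sigma>\<in>K. openin (top_of_set \<sigma>) (\<sigma> \<inter> U))"
    then show "\<Union>\<U> \<subseteq> \<Union>K" by blast
    fix \<sigma> assume "\<sigma> \<in> K"
    then have "openin (top_of_set \<sigma>) (\<Union>U\<in>\<U>. \<sigma> \<inter> U)"
      using U by (intro openin_Union) blast
    moreover have "(\<Union>U\<in>\<U>. \<sigma> \<inter> U) = \<sigma> \<inter> \<Union>\<U>" by blast
    ultimately show "openin (top_of_set \<sigma>) (\<sigma> \<inter> \<Union>\<U>)" by metis
  qed
  then show ?thesis
    by (simp add: realization_def topology_inverse')
qed

definition faces :: "'v::real_vector set \<Rightarrow> 'v set set" where
  "faces \<beta> = {\<tau>. \<tau> face_of \<beta> \<and> \<tau> \<noteq> {}}"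

definition boundary_complex :: "'v::real_vector set \<Rightarrow> 'v set set" where
  "boundary_complex \<beta> = {\<tau>. \<tau> face_of \<beta> \<and> \<tau> \<noteq> {} \<and> \<tau> \<noteq> \<beta>}"

text \<open>
  In a complex, \<open>\<beta>\<close> and a disjoint \<open>\<sigma>\<close> are faces of \<open>convex hull (\<beta> \<union> \<sigma>)\<close> as soon as the latter
  is a simplex of the complex, so it is then their join.
\<close>

definition link :: "'v::real_vector set set \<Rightarrow> 'v set \<Rightarrow> 'v set set" where
  "link K \<beta> = {\<sigma>\<in>K. \<beta> \<inter> \<sigma> = {} \<and> convex hull (\<beta> \<union> \<sigma>) \<in> K}"

text \<open>
  Complexes do not contain the empty simplex, so both factors are included separately; in
  particular \<open>complex_join {} E = E\<close>.
\<close>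

definition complex_join :: "'v::real_vector set set \<Rightarrow> 'v set set \<Rightarrow> 'v set set" where
  "complex_join E E' = E \<union> E' \<union> {convex hull (\<sigma> \<union> \<tau>) |\<sigma> \<tau>. \<sigma> \<in> E \<and> \<tau> \<in> E'}"

section \<open>Filtrations, strata, perversities\<close>

text \<open>
  A filtered complex is \<open>F 0 \<subseteq> \<dots> \<subseteq> F n = K\<close>; values \<open>F i\<close> with \<open>i > n\<close> play no role.
\<close>

definition filtered_complex :: "(nat \<Rightarrow> 'v::real_vector set set) \<Rightarrow> nat \<Rightarrow> bool" where
  "filtered_complex F n \<longleftrightarrow>
     geom_complex (F n) \<and> (\<forall>l\<le>n. subcomplex (F l) (F n)) \<and> (\<forall>l<n. F l \<subseteq> F (Suc l))"

definition full_filtration :: "(nat \<Rightarrow> 'v::real_vector set set) \<Rightarrow> nat \<Rightarrow> bool" where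
  "full_filtration F n \<longleftrightarrow>
     (\<forall>l\<le>n. \<forall>\<sigma>\<in>F n. (\<forall>v\<in>verts \<sigma>. {v} \<in> F l) \<longrightarrow> \<sigma> \<in> F l)"

text \<open>\<open>F (i - 1)\<close>, with the convention that \<open>F (-1)\<close> is empty.\<close>

definition filt_pred :: "(nat \<Rightarrow> 'v set set) \<Rightarrow> nat \<Rightarrow> 'v set set" where
  "filt_pred F i = (case i of 0 \<Rightarrow> {} | Suc j \<Rightarrow> F j)"

text \<open>The strata of virtual dimension \<open>i\<close>, i.e. of virtual codimension \<open>n - i\<close>.\<close>

definition strata :: "(nat \<Rightarrow> 'v::topological_space set set) \<Rightarrow> nat \<Rightarrow> nat \<Rightarrow> 'v set set" where
  "strata F n i =
     connected_components_of (subtopology (realization (F n)) (\<Union>(F i) - \<Union>(filt_pred F i)))"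

definition all_strata :: "(nat \<Rightarrow> 'v::topological_space set set) \<Rightarrow> nat \<Rightarrow> 'v set set" where
  "all_strata F n = (\<Union>i\<in>{0..n}. strata F n i)"

text \<open>A perversity is a function on point sets of which only the values on strata matter.\<close>

definition perversity ::
    "(nat \<Rightarrow> 'v::topological_space set set) \<Rightarrow> nat \<Rightarrow> ('v set \<Rightarrow> ereal) \<Rightarrow> bool" where
  "perversity F n p \<longleftrightarrow>
     (\<forall>S\<in>all_strata F n. p S \<in> range (\<lambda>k::int. ereal (real_of_int k)) \<union> {-\<infinity>, \<infinity>}) \<and>
     (\<forall>S\<in>strata F n n. p S = 0)"

definition induced_filtration ::
    "(nat \<Rightarrow> 'v set set) \<Rightarrow> 'v set set \<Rightarrow> nat \<Rightarrow> 'v set set" where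
  "induced_filtration F L = (\<lambda>i. L \<inter> F i)"

definition induced_perversity ::
    "(nat \<Rightarrow> 'v::topological_space set set) \<Rightarrow> nat \<Rightarrow> ('v set \<Rightarrow> ereal) \<Rightarrow> 'v set \<Rightarrow> ereal" where
  "induced_perversity F n p T = p (THE S. S \<in> all_strata F n \<and> T \<subseteq> S)"

section \<open>Complexity, clots, residual complex\<close>

text \<open>The complexity of a non-empty \<open>F n\<close> is the pair \<open>(comp_a F n, comp_b F n)\<close>.\<close>

definition comp_a :: "(nat \<Rightarrow> 'v set set) \<Rightarrow> nat \<Rightarrow> nat" where
  "comp_a F n = Max {k\<in>{0..n}. F (n - k) \<noteq> {}}"

definition comp_b :: "(nat \<Rightarrow> 'v::real_vector set set) \<Rightarrow> nat \<Rightarrow> ereal" where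
  "comp_b F n = complex_dim (F (n - comp_a F n))"

definition clots :: "(nat \<Rightarrow> 'v::real_vector set set) \<Rightarrow> nat \<Rightarrow> 'v set set" where
  "clots F n = {\<beta>\<in>F (n - comp_a F n). ereal (real (sdim \<beta>)) = comp_b F n}"

definition residual :: "(nat \<Rightarrow> 'v::real_vector set set) \<Rightarrow> nat \<Rightarrow> 'v set set" where
  "residual F n = {\<sigma>\<in>F n. dimension (\<sigma> \<inter> \<Union>(F (n - comp_a F n))) < comp_b F n}"

section \<open>Oriented simplicial chains\<close>

text \<open>
  An oriented \<open>q\<close>-chain is a finitely supported alternating function on the orderings
  \<open>[v\<^sub>0, \<dots>, v\<^sub>q]\<close> of the vertices of the \<open>q\<close>-simplices: its value there is the coefficient of the
  oriented simplex \<open>[v\<^sub>0, \<dots>, v\<^sub>q]\<close>. With this encoding no orientations have to be chosen, and the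
  formula \<open>\<partial>[v\<^sub>0, \<dots>, v\<^sub>q] = \<Sum>\<^sub>i (-1)\<^sup>i [v\<^sub>0, \<dots>, v\<^bsub>i-1\<^esub>, v\<^bsub>i+1\<^esub>, \<dots>, v\<^sub>q]\<close> says that the coefficient of
  \<open>\<partial>c\<close> at \<open>w\<close> is the sum over all \<open>v\<close> of the coefficients of \<open>c\<close> at \<open>v # w\<close>. Chain complexes
  are not augmented, whence the value \<open>0\<close> at the empty list.
\<close>

definition oriented_chains ::
    "'v::real_vector set set \<Rightarrow> nat \<Rightarrow> ('v list \<Rightarrow> 'r::ab_group_add) set" where
  "oriented_chains K q =
     {c. (\<forall>w. c w \<noteq> 0 \<longrightarrow> length w = Suc q \<and> distinct w \<and> (\<exists>\<sigma>\<in>K. set w = verts \<sigma>)) \<and>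
         (\<forall>w \<pi>. \<pi> permutes {..<length w} \<longrightarrow>
            c (permute_list \<pi> w) = (if evenperm \<pi> then c w else - c w)) \<and>
         finite {w. c w \<noteq> 0}}"

definition chain_bd :: "('v list \<Rightarrow> 'r::ab_group_add) \<Rightarrow> 'v list \<Rightarrow> 'r" where
  "chain_bd c w = (if w = [] then 0 else (\<Sum>v | c (v # w) \<noteq> 0. c (v # w)))"

definition allowable ::
    "(nat \<Rightarrow> 'v::real_normed_vector set set) \<Rightarrow> nat \<Rightarrow> ('v set \<Rightarrow> ereal) \<Rightarrow> 'v set \<Rightarrow> bool" where
  "allowable F n p \<sigma> \<longleftrightarrow>
     (\<forall>i\<le>n. \<forall>S\<in>strata F n i.
        dimension (\<sigma> \<inter> S) \<le> ereal (real (sdim \<sigma>) - real (n - i)) + p S)"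

definition intersection_chains ::
    "(nat \<Rightarrow> 'v::real_normed_vector set set) \<Rightarrow> nat \<Rightarrow> ('v set \<Rightarrow> ereal) \<Rightarrow> nat
      \<Rightarrow> ('v list \<Rightarrow> 'r::ab_group_add) set" where
  "intersection_chains F n p q =
     {c \<in> oriented_chains (F n) q.
        \<forall>w. c w \<noteq> 0 \<or> chain_bd c w \<noteq> 0 \<longrightarrow> allowable F n p (convex hull (set w))}"

section \<open>Chain complexes\<close>

text \<open>
  Non-negatively graded chain complexes of abelian groups, written as multiplicative
  HOL-Algebra groups; \<open>diff C q\<close> maps degree \<open>q + 1\<close> to degree \<open>q\<close>.
\<close>

record 'a chain_complex =
  grp :: "nat \<Rightarrow> 'a monoid"
  diff :: "nat \<Rightarrow> 'a \<Rightarrow> 'a"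

definition is_chain_complex :: "'a chain_complex \<Rightarrow> bool" where
  "is_chain_complex C \<longleftrightarrow>
     (\<forall>q. comm_group (grp C q)) \<and>
     (\<forall>q. diff C q \<in> hom (grp C (Suc q)) (grp C q)) \<and>
     (\<forall>q. \<forall>x\<in>carrier (grp C (Suc (Suc q))). diff C q (diff C (Suc q) x) = \<one>\<^bsub>grp C q\<^esub>)"

definition chain_subcomplex :: "'a chain_complex \<Rightarrow> 'a chain_complex \<Rightarrow> bool" where
  "chain_subcomplex D C \<longleftrightarrow>
     is_chain_complex D \<and> is_chain_complex C \<and>
     (\<forall>q. subgroup (carrier (grp D q)) (grp C q)) \<and>
     (\<forall>q. \<forall>x\<in>carrier (grp D q). \<forall>y\<in>carrier (grp D q).
        x \<otimes>\<^bsub>grp D q\<^esub> y = x \<otimes>\<^bsub>grp C q\<^esub> y) \<and>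
     (\<forall>q. \<forall>x\<in>carrier (grp D (Suc q)). diff D q x = diff C q x)"

text \<open>
  In the quotient, the differential of the coset of \<open>x\<close> is the coset of \<open>diff C q x\<close>, written
  without a choice of representative.
\<close>

definition quotient_complex :: "'a chain_complex \<Rightarrow> 'a chain_complex \<Rightarrow> 'a set chain_complex" where
  "quotient_complex C D =
     \<lparr>grp = (\<lambda>q. grp C q Mod carrier (grp D q)),
      diff = (\<lambda>q X. carrier (grp D q) <#>\<^bsub>grp C q\<^esub> (diff C q ` X))\<rparr>"

definition direct_sum_complex ::
    "'i set \<Rightarrow> ('i \<Rightarrow> 'a chain_complex) \<Rightarrow> ('i \<Rightarrow> 'a) chain_complex" where
  "direct_sum_complex I C =
     \<lparr>grp = (\<lambda>q. sum_group I (\<lambda>i. grp (C i) q)),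
      diff = (\<lambda>q f. \<lambda>i\<in>I. diff (C i) q (f i))\<rparr>"

definition chain_iso ::
    "'a chain_complex \<Rightarrow> 'b chain_complex \<Rightarrow> (nat \<Rightarrow> 'a \<Rightarrow> 'b) \<Rightarrow> bool" where
  "chain_iso C C' \<phi> \<longleftrightarrow>
     is_chain_complex C \<and> is_chain_complex C' \<and>
     (\<forall>q. \<phi> q \<in> iso (grp C q) (grp C' q)) \<and>
     (\<forall>q. \<forall>x\<in>carrier (grp C (Suc q)). \<phi> q (diff C q x) = diff C' q (\<phi> (Suc q) x))"

text \<open>
  Given subcomplexes \<open>A\<^sub>i \<subseteq> C\<close> and \<open>B\<^sub>i \<subseteq> A\<^sub>i \<inter> D\<close>, the inclusion induces
  \<open>A\<^sub>i / B\<^sub>i \<rightarrow> C / D\<close>, sending the coset \<open>X = x + B\<^sub>i\<close> to \<open>x + D = D + X\<close>. This is the sum over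
  \<open>i \<in> I\<close> of these maps in degree \<open>q\<close>, on finitely supported families of cosets.
\<close>

definition sum_of_inclusions ::
    "'i set \<Rightarrow> 'a chain_complex \<Rightarrow> 'a chain_complex \<Rightarrow> nat \<Rightarrow> ('i \<Rightarrow> 'a set) \<Rightarrow> 'a set" where
  "sum_of_inclusions I C D q f =
     gfinprod (grp (quotient_complex C D) q)
       (\<lambda>i. carrier (grp D q) <#>\<^bsub>grp C q\<^esub> f i) I"

definition intersection_complex ::
    "(nat \<Rightarrow> 'v::real_normed_vector set set) \<Rightarrow> nat \<Rightarrow> ('v set \<Rightarrow> ereal)
      \<Rightarrow> ('v list \<Rightarrow> 'r::ab_group_add) chain_complex" where
  "intersection_complex F n p =
     \<lparr>grp = (\<lambda>q. \<lparr>carrier = intersection_chains F n p q,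
                   monoid.mult = (\<lambda>c c' w. c w + c' w),
                   one = (\<lambda>w. 0)\<rparr>),
      diff = (\<lambda>q. chain_bd)\<rparr>"

text \<open>The intersection chains of a subcomplex \<open>L\<close> with induced filtration and perversity.\<close>

definition sub_intersection_complex ::
    "(nat \<Rightarrow> 'v::real_normed_vector set set) \<Rightarrow> nat \<Rightarrow> ('v set \<Rightarrow> ereal) \<Rightarrow> 'v set set
      \<Rightarrow> ('v list \<Rightarrow> 'r::ab_group_add) chain_complex" where
  "sub_intersection_complex F n p L =
     intersection_complex (induced_filtration F L) n (induced_perversity F n p)"

end

theory Submission
  imports Defs
begin

text \<open>
  Let \<open>V\<close> be the set of vertices of the first non-empty term \<open>K\<^sub>m\<close> of the filtration of \<open>K\<close>. By
  fullness, a simplex \<open>\<sigma>\<close> of \<open>K\<close> meets \<open>|K\<^sub>m|\<close> in the face spanned by the vertices of \<open>\<sigma>\<close> in \<open>V\<close>,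
  which is empty or a simplex of \<open>K\<^sub>m\<close>. So \<open>\<sigma>\<close> lies outside the residual complex if and only if
  this face is a clot, and then it is the only clot contained in \<open>\<sigma>\<close>
  (\<open>mem_residual_iff\<close>, \<open>clot_unique\<close>). The simplices that contain a clot \<open>\<beta>\<close> are exactly those of
  \<open>\<beta> * L\<^sub>\<beta>\<close> that are not in \<open>\<partial>\<beta> * L\<^sub>\<beta>\<close> (\<open>complex_join_faces_link\<close>,
  \<open>complex_join_boundary_link\<close>). Hence a chain of \<open>K\<close> is, modulo chains of the residual complex,
  the sum of its parts \<open>c\<^sub>\<beta>\<close> on the simplices containing \<open>\<beta>\<close>, and without an allowability condition
  the isomorphism is clear.

  What has to be shown is that \<open>c\<^sub>\<beta>\<close> is an intersection chain if \<open>c\<close> is one, that is, that the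
  simplices of its boundary are allowable (\<open>restrict_chain_supported\<close>). Those that contain \<open>\<beta>\<close> have
  the same coefficient in \<open>\<partial>c\<close>. The others arise from allowable simplices by removing a vertex \<open>v\<close> of
  \<open>\<beta>\<close>. Since \<open>v\<close> belongs to all non-empty terms of the filtration, its removal lowers the dimension
  of the simplex and the dimensions of its intersections with strata by one, so the face is
  allowable (\<open>allowable_remove_vertex\<close>).

  Allowability in a subcomplex with the induced filtration and perversity agrees with allowability
  in \<open>K\<close> (\<open>induced_allowable_iff\<close>), because a simplex of a full filtered complex meets
  \<open>|K\<^sub>i| - |K\<^bsub>i-1\<^esub>|\<close> in a convex set, hence in at most one stratum. All complexes in question thus
  consist of the intersection chains of \<open>K\<close> with support in a subcomplex, and the projections
  \<open>c \<mapsto> c\<^sub>\<beta>\<close> give the direct sum decomposition (\<open>chain_iso_sum_of_inclusions\<close>).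
\<close>

section \<open>Faces and dimensions of simplices\<close>

text \<open>
  A common point would have two different affine expressions in the points of \<open>C\<close>; their
  difference is an affine dependence.
\<close>

lemma affine_hull_disjoint_convex_hull_Diff:
  fixes C :: "'v::real_vector set"
  assumes "finite C" "\<not> affine_dependent C" "T \<subseteq> C"
  shows "affine hull T \<inter> convex hull (C - T) = {}"
proof (rule ccontr)
  assume "\<not> ?thesis"
  then obtain y where y: "y \<in> affine hull T" "y \<in> convex hull (C - T)" by blast
  have fin: "finite T" "finite (C - T)"
    using assms finite_subset by auto
  obtain a where a: "sum a T = 1" "(\<Sum>v\<in>T. a v *\<^sub>R v) = y"
    using y(1) by (auto simp: affine_hull_finite[OF fin(1)])
  obtain b where b: "sum b (C - T) = 1" "(\<Sum>v\<in>C - T. b v *\<^sub>R v) = y"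
    using y(2) by (auto simp: convex_hull_finite[OF fin(2)])
  \<comment> \<open>The difference of the two expressions.\<close>
  define u where "u v = (if v \<in> T then a v else - b v)" for v
  have split: "sum g C = sum g T + sum g (C - T)" for g :: "'v \<Rightarrow> 'b::comm_monoid_add"
    using assms by (metis sum.subset_diff add.commute)
  have "sum u C = 0"
  proof -
    have "sum u T = sum a T" "sum u (C - T) = - sum b (C - T)"
      by (auto simp: u_def sum_negf[symmetric] intro!: sum.cong)
    with split[of u] a b show ?thesis by simp
  qed
  moreover have "(\<Sum>v\<in>C. u v *\<^sub>R v) = 0"
  proof -
    have "(\<Sum>v\<in>T. u v *\<^sub>R v) = (\<Sum>v\<in>T. a v *\<^sub>R v)"
      "(\<Sum>v\<in>C - T. u v *\<^sub>R v) = - (\<Sum>v\<in>C - T. b v *\<^sub>R v)"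
      by (auto simp: u_def sum_negf[symmetric] intro!: sum.cong)
    with split[of "\<lambda>v. u v *\<^sub>R v"] a(2) b(2) show ?thesis by simp
  qed
  moreover have "\<exists>v\<in>C. u v \<noteq> 0"
  proof -
    obtain v where "v \<in> T" "a v \<noteq> 0"
      using a(1) by (metis sum.neutral zero_neq_one)
    then show ?thesis using assms by (auto simp: u_def)
  qed
  ultimately show False
    using assms(1,2) by (auto simp: affine_dependent_explicit_finite)
qed

lemma face_of_simplex_hull:
  fixes C :: "'v::real_vector set"
  assumes "finite C" "\<not> affine_dependent C" "A \<subseteq> C"
  shows "convex hull A face_of convex hull C"
  by (rule face_of_convex_hulls) (use assms affine_hull_disjoint_convex_hull_Diff in auto)

text \<open>
  The vertices of a face of a polytope are vertices of the polytope. The polytope is built up one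
  point \<open>a\<close> at a time: a point of the face lies on a segment from \<open>a\<close> to the hull of the other
  points, and if it is interior to the segment then the face contains both ends.
\<close>

lemma face_of_finite_hull:
  fixes C :: "'v::real_vector set"
  assumes "finite C" "T face_of convex hull C"
  shows "T = convex hull (C \<inter> T)"
proof
  show "convex hull (C \<inter> T) \<subseteq> T"
    using assms(2) by (intro hull_minimal) (auto simp: face_of_def)
  show "T \<subseteq> convex hull (C \<inter> T)"
    using assms
  proof (induction C arbitrary: T)
    case empty
    then show ?case by simp
  next
    case (insert a C)
    show ?case
    proof
      fix x assume x: "x \<in> T"
      show "x \<in> convex hull (insert a C \<inter> T)"
      proof (cases "C = {}")
        case True
        with x insert.prems have "x = a" by (auto simp: face_of_def)
        with x show ?thesis by (auto intro: hull_inc)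
      next
        case False
        have xC: "x \<in> convex hull (insert a C)"
          using insert.prems x by (auto simp: face_of_def)
        then obtain y where y: "y \<in> convex hull C" "x \<in> closed_segment a y"
          using False by (auto simp: convex_hull_insert_segments)
        have T': "T \<inter> convex hull C face_of convex hull C"
        proof -
          have "T \<inter> convex hull C face_of convex hull (insert a C) \<inter> convex hull C"
            by (rule face_of_slice) (use insert.prems in auto)
          moreover have "convex hull (insert a C) \<inter> convex hull C = convex hull C"
            using hull_mono[of C "insert a C" convex] by auto
          ultimately show ?thesis by simp
        qed
        have IH: "T \<inter> convex hull C \<subseteq> convex hull (insert a C \<inter> T)"
          using insert.IH[OF T'] hull_mono[of "C \<inter> (T \<inter> convex hull C)" "insert a C \<inter> T" convex]
          by auto
        consider "x = a" | "x = y" | "x \<in> open_segment a y"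
          using y(2) by (auto simp: open_segment_def)
        then show ?thesis
        proof cases
          case 1
          then show ?thesis using x by (auto intro: hull_inc)
        next
          case 2
          then show ?thesis using x y IH by auto
        next
          case 3
          have "y \<in> convex hull (insert a C)"
            using y(1) hull_mono[of C "insert a C" convex] by auto
          moreover have "a \<in> convex hull (insert a C)" by (simp add: hull_inc)
          ultimately have aT: "a \<in> T" "y \<in> T"
            using face_ofD[OF insert.prems 3 _ _ x] by blast+
          have "a \<in> convex hull (insert a C \<inter> T)" using aT by (auto intro: hull_inc)
          moreover have "y \<in> convex hull (insert a C \<inter> T)" using aT y IH by auto
          ultimately show ?thesis
            using y(2) by (meson closed_segment_subset convex_convex_hull subsetD)
        qed
      qed
    qed
  qed
qed

lemma verts_simplex_hull [simp]:
  fixes C :: "'v::real_vector set"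
  assumes "finite C" "\<not> affine_dependent C"
  shows "verts (convex hull C) = C"
proof
  show "verts (convex hull C) \<subseteq> C"
    by (auto simp: verts_def extreme_point_of_convex_hull)
  show "C \<subseteq> verts (convex hull C)"
    using face_of_simplex_hull[OF assms, of "{_}"] by (auto simp: verts_def face_of_singleton[symmetric])
qed

lemma geom_simplex_verts:
  assumes "geom_simplex \<sigma>"
  shows "finite (verts \<sigma>)" "verts \<sigma> \<noteq> {}" "\<not> affine_dependent (verts \<sigma>)"
    "convex hull (verts \<sigma>) = \<sigma>"
  using assms by (auto simp: geom_simplex_def)

lemma geom_simplex_hull:
  assumes "geom_simplex \<sigma>" "A \<subseteq> verts \<sigma>" "A \<noteq> {}"
  shows "geom_simplex (convex hull A)" "verts (convex hull A) = A"
proof -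
  have "finite A" "\<not> affine_dependent A"
    using geom_simplex_verts[OF assms(1)] assms(2) finite_subset affine_dependent_subset by blast+
  then show "geom_simplex (convex hull A)" "verts (convex hull A) = A"
    using assms(3) by (auto simp: geom_simplex_def)
qed

text \<open>
  Faces of a simplex correspond to non-empty sets of vertices, so incidences of simplices can be
  expressed by inclusions of vertex sets.
\<close>

lemma face_of_geom_simplex_iff:
  assumes "geom_simplex \<sigma>" "\<tau> \<noteq> {}"
  shows "\<tau> face_of \<sigma> \<longleftrightarrow> geom_simplex \<tau> \<and> verts \<tau> \<subseteq> verts \<sigma>"
proof
  note s = geom_simplex_verts[OF assms(1)]
  assume "\<tau> face_of \<sigma>"
  then have t: "\<tau> = convex hull (verts \<sigma> \<inter> \<tau>)"
    using face_of_finite_hull[of "verts \<sigma>" \<tau>] s by simp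
  with assms(2) have "verts \<sigma> \<inter> \<tau> \<noteq> {}" by (metis convex_hull_empty)
  with geom_simplex_hull[OF assms(1), of "verts \<sigma> \<inter> \<tau>"] t
  show "geom_simplex \<tau> \<and> verts \<tau> \<subseteq> verts \<sigma>" by simp
next
  assume "geom_simplex \<tau> \<and> verts \<tau> \<subseteq> verts \<sigma>"
  then show "\<tau> face_of \<sigma>"
    using face_of_simplex_hull[of "verts \<sigma>" "verts \<tau>"] geom_simplex_verts assms(1) by metis
qed

lemma geom_simplex_hull_Int:
  assumes "geom_simplex \<sigma>" "A \<subseteq> verts \<sigma>" "B \<subseteq> verts \<sigma>"
  shows "convex hull A \<inter> convex hull B = convex hull (A \<inter> B)"
proof -
  note s = geom_simplex_verts[OF assms(1)]
  have face: "convex hull D face_of \<sigma>" if "D \<subseteq> verts \<sigma>" for D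
    using face_of_simplex_hull[of "verts \<sigma>" D] s that by simp
  have Int: "verts \<sigma> \<inter> convex hull D = D" if "D \<subseteq> verts \<sigma>" for D
  proof -
    have "v \<in> D" if "v \<in> verts \<sigma>" "v \<in> convex hull D" for v
    proof -
      have "v extreme_point_of convex hull D"
        using that extreme_point_of_face[OF face[OF \<open>D \<subseteq> verts \<sigma>\<close>]] by (auto simp: verts_def)
      then show ?thesis by (rule extreme_point_of_convex_hull)
    qed
    then show ?thesis using that by (auto intro: hull_inc)
  qed
  have "convex hull A \<inter> convex hull B face_of \<sigma>"
    using face assms(2,3) by (intro face_of_Int) auto
  then have "convex hull A \<inter> convex hull B =
      convex hull (verts \<sigma> \<inter> (convex hull A \<inter> convex hull B))"
    using face_of_finite_hull[of "verts \<sigma>"] s by simp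
  moreover have "verts \<sigma> \<inter> (convex hull A \<inter> convex hull B) = A \<inter> B"
    using Int assms by blast
  ultimately show ?thesis by simp
qed

lemma verts_subset: "verts \<sigma> \<subseteq> \<sigma>"
  by (auto simp: verts_def extreme_point_of_def)

lemma geom_simplex_nonempty: "geom_simplex \<sigma> \<Longrightarrow> \<sigma> \<noteq> {}"
  by (auto simp: geom_simplex_def)

lemma card_verts_eq: "geom_simplex \<sigma> \<Longrightarrow> card (verts \<sigma>) = Suc (sdim \<sigma>)"
  using geom_simplex_verts[of \<sigma>] by (simp add: sdim_def card_gt_0_iff Suc_diff_1)

text \<open>
  The simplices need not be related as faces, so this is a statement about affine independence:
  the edge vectors of \<open>\<tau>\<close> at one vertex are independent and lie in the span of those of \<open>\<sigma>\<close>.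
\<close>

lemma sdim_mono:
  assumes "geom_simplex \<sigma>" "geom_simplex \<tau>" "\<tau> \<subseteq> \<sigma>"
  shows "sdim \<tau> \<le> sdim \<sigma>"
proof -
  note s = geom_simplex_verts[OF assms(1)] and t = geom_simplex_verts[OF assms(2)]
  obtain a where a: "a \<in> verts \<tau>" using t by blast
  define f where "f = (\<lambda>x. - a + x :: 'a)"
  have inj: "inj_on f A" for A by (auto simp: f_def inj_on_def)
  have i: "independent (f ` (verts \<tau> - {a}))"
    using affine_dependent_iff_dependent2[OF a] t by (simp add: f_def)
  obtain b where b: "b \<in> verts \<sigma>" using s by blast
  have "a \<in> affine hull (verts \<sigma>)"
    using a verts_subset assms(3) s(4) convex_hull_subset_affine_hull by (metis subsetD)
  define g where "g = (\<lambda>x. x - b)"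
  have span: "x - b \<in> span (g ` (verts \<sigma> - {b}))" if x: "x \<in> \<sigma>" for x
  proof -
    from x s(4) have "x \<in> affine hull (verts \<sigma>)"
      using convex_hull_subset_affine_hull by blast
    then have "x \<in> affine hull (insert b (verts \<sigma> - {b}))" using b by (simp add: insert_absorb)
    then show ?thesis
      unfolding affine_hull_insert_span_gen g_def by (auto simp: algebra_simps)
  qed
  have sub: "f ` (verts \<tau> - {a}) \<subseteq> span (g ` (verts \<sigma> - {b}))"
  proof
    fix y assume "y \<in> f ` (verts \<tau> - {a})"
    then obtain x where "x \<in> verts \<tau>" "y = (x - b) - (a - b)" by (auto simp: f_def)
    then show "y \<in> span (g ` (verts \<sigma> - {b}))"
      using span_diff[OF span[of x] span[of a]] a verts_subset[of \<tau>] assms(3) by blast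
  qed
  have "card (f ` (verts \<tau> - {a})) \<le> card (g ` (verts \<sigma> - {b}))"
    using independent_span_bound[OF _ i sub] s by auto
  also have "\<dots> \<le> card (verts \<sigma> - {b})"
    by (rule card_image_le) (use s in auto)
  finally show ?thesis
    using a b s t card_image[OF inj[of "verts \<tau> - {a}"]] by (simp add: sdim_def)
qed

lemma dimension_mono: "A \<subseteq> B \<Longrightarrow> dimension A \<le> dimension B"
  unfolding dimension_def by (rule SUP_subset_mono) auto

lemma dimension_empty [simp]: "dimension {} = -\<infinity>"
proof -
  have "{\<tau>. geom_simplex \<tau> \<and> \<tau> \<subseteq> {}} = {}" using geom_simplex_nonempty by auto
  then show ?thesis unfolding dimension_def by (metis SUP_empty bot_ereal_def)
qed

lemma dimension_geom_simplex:
  assumes "geom_simplex \<sigma>"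
  shows "dimension \<sigma> = ereal (real (sdim \<sigma>))"
  unfolding dimension_def
  by (rule antisym) (auto intro!: SUP_least SUP_upper2[of \<sigma>] simp: sdim_mono assms)

lemma dimension_hull_le:
  assumes "geom_simplex \<sigma>" "A \<subseteq> verts \<sigma>" "A \<noteq> {}" "D \<subseteq> convex hull A"
  shows "dimension D \<le> ereal (real (card A) - 1)"
proof -
  note a = geom_simplex_hull[OF assms(1-3)]
  have "dimension D \<le> dimension (convex hull A)" by (rule dimension_mono) fact
  also have "\<dots> = ereal (real (card A) - 1)"
    using dimension_geom_simplex[OF a(1)] card_verts_eq[OF a(1)] a(2) by simp
  finally show ?thesis .
qed

lemma independent_scale_half:
  fixes S :: "'v::real_vector set"
  assumes "independent S"
  shows "independent ((*\<^sub>R) (1/2) ` S)"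
  by (rule linear_independent_injective_image[OF _ assms]) (auto simp: inj_on_def linear_scaleR)

text \<open>
  Removing a face keeps a set convex. This is what makes the trace of a stratum on a simplex
  connected.
\<close>

lemma convex_Diff_face:
  assumes "T face_of S" "convex S"
  shows "convex (S - T)"
  using assms unfolding convex_contains_open_segment face_of_def by blast

text \<open>
  Removing a proper face does not lower the dimension of a simplex: a smaller copy of the simplex
  near a vertex \<open>v\<close> outside the face avoids the face.
\<close>

lemma dimension_hull_Diff_ge:
  assumes s: "geom_simplex \<sigma>" and A: "A \<subseteq> verts \<sigma>" and B: "B \<subseteq> A" and v: "v \<in> A" "v \<notin> B"
  shows "ereal (real (card A) - 1) \<le> dimension (convex hull A - convex hull B)"
proof -
  \<comment> \<open>The homothety with centre \<open>v\<close> and ratio \<open>1/2\<close>.\<close>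
  define f where "f x = (1/2) *\<^sub>R v + (1/2) *\<^sub>R x" for x :: 'a
  have a: "finite A" "\<not> affine_dependent A"
    using geom_simplex_verts[OF s] A finite_subset affine_dependent_subset by blast+
  have inj: "inj_on f S" for S by (auto simp: inj_on_def f_def)
  have fA: "\<not> affine_dependent (f ` A)"
  proof -
    have fv: "f v = v" by (simp add: f_def flip: scaleR_add_left)
    then have v': "v \<in> f ` A" using v by force
    have eq: "(\<lambda>x. - v + x) ` (f ` A - {v}) = (*\<^sub>R) (1/2) ` ((\<lambda>x. - v + x) ` (A - {v}))"
    proof -
      have 1: "f ` A - {v} = f ` (A - {v})" using fv inj[of UNIV] by (force simp: inj_on_def)
      have h: "f x - v = (1/2) *\<^sub>R (x - v)" for x
      proof -
        have "v = (1/2) *\<^sub>R v + (1/2) *\<^sub>R v" by (simp flip: scaleR_add_left)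
        then have "f x - v = (1/2) *\<^sub>R v + (1/2) *\<^sub>R x - ((1/2) *\<^sub>R v + (1/2) *\<^sub>R v)" by (simp add: f_def)
        then show ?thesis by (simp add: scaleR_diff_right)
      qed
      show ?thesis unfolding 1 image_image by (rule image_cong) (use h in auto)
    qed
    have "independent ((\<lambda>x. - v + x) ` (A - {v}))"
      using affine_dependent_iff_dependent2[OF v(1)] a by blast
    then have "independent ((*\<^sub>R) (1/2) ` ((\<lambda>x. - v + x) ` (A - {v})))"
      by (rule independent_scale_half)
    then show ?thesis unfolding affine_dependent_iff_dependent2[OF v'] eq .
  qed
  then have g: "geom_simplex (convex hull (f ` A))" "verts (convex hull (f ` A)) = f ` A"
    using a v by (auto simp: geom_simplex_def)
  have F: "convex hull B face_of convex hull A"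
    by (rule face_of_simplex_hull) (use a B in auto)
  have vB: "v \<notin> convex hull B"
    using geom_simplex_hull_Int[OF s, of "{v}" B] A B v by auto
  have "f x \<in> convex hull A - convex hull B" if x: "x \<in> A" for x
  proof
    have hv: "v \<in> convex hull A" "x \<in> convex hull A" using v x by (auto intro: hull_inc)
    then show "f x \<in> convex hull A"
      unfolding f_def by (intro convexD) auto
    show "f x \<notin> convex hull B"
    proof
      assume fx: "f x \<in> convex hull B"
      show False
      proof (cases "x = v")
        case True
        then show False using fx vB by (simp add: f_def flip: scaleR_add_left)
      next
        case False
        then have "f x \<in> open_segment v x"
          by (auto simp: f_def in_segment intro!: exI[of _ "1/2"])
        then show False using face_ofD[OF F] hv fx vB by blast
      qed
    qed
  qed
  then have "convex hull (f ` A) \<subseteq> convex hull A - convex hull B"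
    by (intro hull_minimal convex_Diff_face F) auto
  then have "dimension (convex hull (f ` A)) \<le> dimension (convex hull A - convex hull B)"
    by (rule dimension_mono)
  moreover have "dimension (convex hull (f ` A)) = ereal (real (card A) - 1)"
    using dimension_geom_simplex[OF g(1)] card_verts_eq[OF g(1)] g(2) card_image[OF inj[of A]] by simp
  ultimately show ?thesis by simp
qed

section \<open>Full filtrations\<close>

lemma geom_complexD:
  assumes "geom_complex K" "\<sigma> \<in> K"
  shows "geom_simplex \<sigma>"
    and "\<lbrakk>\<tau> face_of \<sigma>; \<tau> \<noteq> {}\<rbrakk> \<Longrightarrow> \<tau> \<in> K"
    and "\<lbrakk>\<tau> \<in> K; \<sigma> \<inter> \<tau> \<noteq> {}\<rbrakk> \<Longrightarrow> (\<sigma> \<inter> \<tau>) face_of \<sigma> \<and> (\<sigma> \<inter> \<tau>) face_of \<tau>"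
  using assms by (auto simp: geom_complex_def)

lemma subcomplexD:
  assumes "subcomplex L K"
  shows "L \<subseteq> K" and "\<lbrakk>\<sigma> \<in> L; \<tau> face_of \<sigma>; \<tau> \<noteq> {}\<rbrakk> \<Longrightarrow> \<tau> \<in> L"
  using assms by (auto simp: subcomplex_def)

lemma subcomplex_refl: "geom_complex K \<Longrightarrow> subcomplex K K"
  by (auto simp: subcomplex_def geom_complex_def)

lemma geom_complex_subcomplex:
  assumes K: "geom_complex K" and L: "subcomplex L K"
  shows "geom_complex L"
  unfolding geom_complex_def
proof (intro conjI)
  have LK: "\<sigma> \<in> K" if "\<sigma> \<in> L" for \<sigma> using that subcomplexD(1)[OF L] by blast
  show "\<forall>\<sigma>\<in>L. geom_simplex \<sigma>" using geom_complexD(1)[OF K LK] by blast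
  show "\<forall>\<sigma>\<in>L. \<forall>\<tau>. \<tau> face_of \<sigma> \<and> \<tau> \<noteq> {} \<longrightarrow> \<tau> \<in> L" using subcomplexD(2)[OF L] by blast
  show "\<forall>\<sigma>\<in>L. \<forall>\<tau>\<in>L. \<sigma> \<inter> \<tau> \<noteq> {} \<longrightarrow> (\<sigma> \<inter> \<tau>) face_of \<sigma> \<and> (\<sigma> \<inter> \<tau>) face_of \<tau>"
    using geom_complexD(3)[OF K LK LK] by blast
  show "\<forall>v. {v} \<in> L \<longrightarrow> finite {\<sigma> \<in> L. v \<in> \<sigma>}"
  proof (intro allI impI)
    fix v assume "{v} \<in> L"
    then have "finite {\<sigma> \<in> K. v \<in> \<sigma>}" using LK K by (simp add: geom_complex_def)
    then show "finite {\<sigma> \<in> L. v \<in> \<sigma>}" by (rule rev_finite_subset) (use LK in auto)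
  qed
qed

lemma subcomplex_hull:
  assumes "geom_complex K" "subcomplex L K" "\<sigma> \<in> L" "A \<subseteq> verts \<sigma>" "A \<noteq> {}"
  shows "convex hull A \<in> L"
proof -
  have s: "geom_simplex \<sigma>" using assms geom_complexD(1) subcomplexD(1) by blast
  note a = geom_simplex_hull[OF s assms(4,5)]
  have "convex hull A face_of \<sigma>"
    using face_of_geom_simplex_iff[OF s] a assms(4) geom_simplex_nonempty by metis
  then show ?thesis
    using subcomplexD(2)[OF assms(2,3)] geom_simplex_nonempty[OF a(1)] by blast
qed

text \<open>
  Simplices of a complex meet in the simplex on their common vertices (empty if there are none),
  because the intersection is a face of both.
\<close>

lemma complex_Int_hull:
  assumes K: "geom_complex K" and "\<sigma> \<in> K" "\<tau> \<in> K"
  shows "\<sigma> \<inter> \<tau> = convex hull (verts \<sigma> \<inter> verts \<tau>)"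
proof
  note st = geom_complexD[OF K assms(2)] geom_complexD[OF K assms(3)]
  have "convex hull (verts \<sigma> \<inter> verts \<tau>) \<subseteq> convex hull (verts \<sigma>)"
    "convex hull (verts \<sigma> \<inter> verts \<tau>) \<subseteq> convex hull (verts \<tau>)"
    by (auto intro!: hull_mono)
  then show "convex hull (verts \<sigma> \<inter> verts \<tau>) \<subseteq> \<sigma> \<inter> \<tau>"
    using geom_simplex_verts(4) st by auto
  show "\<sigma> \<inter> \<tau> \<subseteq> convex hull (verts \<sigma> \<inter> verts \<tau>)"
  proof (cases "\<sigma> \<inter> \<tau> = {}")
    case False
    then have "(\<sigma> \<inter> \<tau>) face_of \<sigma>" "(\<sigma> \<inter> \<tau>) face_of \<tau>" using st assms by blast+
    then have "geom_simplex (\<sigma> \<inter> \<tau>)" "verts (\<sigma> \<inter> \<tau>) \<subseteq> verts \<sigma> \<inter> verts \<tau>"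
      using face_of_geom_simplex_iff[OF _ False] st by auto
    then show ?thesis
      using geom_simplex_verts(4) hull_mono by metis
  qed auto
qed

abbreviation filt_verts :: "(nat \<Rightarrow> 'v set set) \<Rightarrow> nat \<Rightarrow> 'v set" where
  "filt_verts F l \<equiv> {v. {v} \<in> F l}"

locale full_filtered_complex =
  fixes F :: "nat \<Rightarrow> 'v::real_normed_vector set set" and n :: nat
  assumes filtered: "filtered_complex F n" and full: "full_filtration F n"
begin

abbreviation K where "K \<equiv> F n"

lemma complex: "geom_complex K" and level_subcomplex: "l \<le> n \<Longrightarrow> subcomplex (F l) K"
  and level_step: "l < n \<Longrightarrow> F l \<subseteq> F (Suc l)"
  using filtered by (auto simp: filtered_complex_def)

lemma level_mono: "i \<le> j \<Longrightarrow> j \<le> n \<Longrightarrow> F i \<subseteq> F j"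
proof (induction j)
  case (Suc j)
  then show ?case using level_step[of j] by (cases "i = Suc j") auto
qed auto

lemma simplex: "\<sigma> \<in> K \<Longrightarrow> geom_simplex \<sigma>"
  using geom_complexD(1)[OF complex] .

text \<open>
  The use of fullness: a simplex meets the \<open>l\<close>-th term of the filtration in a single face,
  spanned by the vertices of the simplex that belong to it.
\<close>

lemma Int_level:
  assumes s: "\<sigma> \<in> K" and l: "l \<le> n"
  shows "\<sigma> \<inter> \<Union>(F l) = convex hull (verts \<sigma> \<inter> filt_verts F l)"
proof
  let ?A = "verts \<sigma> \<inter> filt_verts F l"
  note F = level_subcomplex[OF l]
  show "\<sigma> \<inter> \<Union>(F l) \<subseteq> convex hull ?A"
  proof
    fix x assume "x \<in> \<sigma> \<inter> \<Union>(F l)"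
    then obtain \<tau> where t: "\<tau> \<in> F l" "x \<in> \<sigma> \<inter> \<tau>" by blast
    have "verts \<sigma> \<inter> verts \<tau> \<subseteq> ?A"
      using subcomplex_hull[OF complex F t(1), of "{_}"] by auto
    moreover have "\<sigma> \<inter> \<tau> = convex hull (verts \<sigma> \<inter> verts \<tau>)"
      using complex_Int_hull[OF complex s] t F by (auto dest: subcomplexD)
    ultimately show "x \<in> convex hull ?A" using t(2) hull_mono by blast
  qed
  show "convex hull ?A \<subseteq> \<sigma> \<inter> \<Union>(F l)"
  proof (cases "?A = {}")
    case False
    have "convex hull ?A \<in> K"
      by (rule subcomplex_hull[OF complex subcomplex_refl[OF complex] s]) (use False in auto)
    moreover have "verts (convex hull ?A) = ?A"
      by (rule geom_simplex_hull[OF simplex[OF s]]) (use False in auto)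
    ultimately have "convex hull ?A \<in> F l"
      using full l unfolding full_filtration_def by blast
    moreover have "convex hull ?A \<subseteq> \<sigma>"
      using hull_mono[of ?A "verts \<sigma>" convex] geom_simplex_verts(4)[OF simplex[OF s]] by auto
    ultimately show ?thesis by blast
  qed auto
qed

lemma Int_level_pred:
  assumes s: "\<sigma> \<in> K" and l: "i \<le> n"
  shows "\<sigma> \<inter> \<Union>(filt_pred F i) = convex hull (verts \<sigma> \<inter> filt_verts (filt_pred F) i)"
  using Int_level[OF s, of "i - 1"] l by (cases i) (auto simp: filt_pred_def)

lemma filt_verts_pred: "i \<le> n \<Longrightarrow> filt_verts (filt_pred F) i \<subseteq> filt_verts F i"
  using level_step[of "i - 1"] by (cases i) (auto simp: filt_pred_def)

abbreviation level_diff where "level_diff i \<equiv> \<Union>(F i) - \<Union>(filt_pred F i)"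

lemma Int_level_diff:
  assumes s: "\<sigma> \<in> K" and l: "i \<le> n"
  shows "\<sigma> \<inter> level_diff i =
    convex hull (verts \<sigma> \<inter> filt_verts F i) - convex hull (verts \<sigma> \<inter> filt_verts (filt_pred F) i)"
  using Int_level[OF assms] Int_level_pred[OF assms] by blast

text \<open>
  By fullness this set is a face minus a smaller face, hence convex. A simplex therefore meets at
  most one stratum of each virtual dimension.
\<close>

lemma connected_Int_level_diff:
  assumes s: "\<sigma> \<in> K" and l: "i \<le> n"
  shows "connected (\<sigma> \<inter> level_diff i)"
proof -
  let ?A = "verts \<sigma> \<inter> filt_verts F i" and ?B = "verts \<sigma> \<inter> filt_verts (filt_pred F) i"
  note v = geom_simplex_verts[OF simplex[OF s]]
  have "finite ?A" "\<not> affine_dependent ?A"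
    using v affine_dependent_subset[of ?A "verts \<sigma>"] by auto
  then have "convex hull ?B face_of convex hull ?A"
    by (rule face_of_simplex_hull) (use filt_verts_pred[OF l] in blast)
  then show ?thesis
    unfolding Int_level_diff[OF assms]
    by (intro convex_connected convex_Diff_face) auto
qed

end

section \<open>Strata and allowability\<close>

lemma connectedin_subset_component:
  assumes "connectedin X T" "T \<noteq> {}"
  shows "\<exists>S\<in>connected_components_of X. T \<subseteq> S"
proof -
  have "X \<noteq> trivial_topology" using connectedin_subset_topspace assms by fastforce
  then show ?thesis using exists_connected_component_of_superset[OF assms(1)] by blast
qed

lemma topspace_realization [simp]: "topspace (realization K) = \<Union>K"
proof
  show "topspace (realization K) \<subseteq> \<Union>K"
    using openin_topspace[of "realization K"] unfolding openin_realization by (rule conjunct1)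
  have "\<sigma> \<inter> \<Union>K = \<sigma>" if "\<sigma> \<in> K" for \<sigma> using that by blast
  then have "openin (realization K) (\<Union>K)"
    by (auto simp: openin_realization)
  then show "\<Union>K \<subseteq> topspace (realization K)" by (rule openin_subset)
qed

text \<open>
  In the coherent topology the inclusions of simplices and of subcomplexes are continuous, so they
  preserve connectedness.
\<close>

lemma connectedin_realization:
  assumes "\<sigma> \<in> K" "connected D" "D \<subseteq> \<sigma>"
  shows "connectedin (realization K) D"
proof -
  have cont: "continuous_map (top_of_set \<sigma>) (realization K) id"
    unfolding continuous_map_def
  proof (intro conjI allI impI)
    show "id \<in> topspace (top_of_set \<sigma>) \<rightarrow> topspace (realization K)" using assms by auto
    fix U assume "openin (realization K) U"
    then have "openin (top_of_set \<sigma>) (\<sigma> \<inter> U)" using assms by (simp add: openin_realization)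
    moreover have "{x \<in> topspace (top_of_set \<sigma>). id x \<in> U} = \<sigma> \<inter> U" by auto
    ultimately show "openin (top_of_set \<sigma>) {x \<in> topspace (top_of_set \<sigma>). id x \<in> U}" by simp
  qed
  have "connectedin (top_of_set \<sigma>) D"
    using assms by (simp add: connectedin_subtopology)
  from connectedin_continuous_map_image[OF cont this] show ?thesis by simp
qed

lemma connectedin_realization_mono:
  assumes "L \<subseteq> K" "connectedin (realization L) D"
  shows "connectedin (realization K) D"
proof -
  have "continuous_map (realization L) (realization K) id"
    unfolding continuous_map_def
  proof (intro conjI allI impI)
    show "id \<in> topspace (realization L) \<rightarrow> topspace (realization K)" using assms by auto
    fix U assume U: "openin (realization K) U"
    have "openin (top_of_set \<sigma>) (\<sigma> \<inter> (U \<inter> \<Union>L))" if "\<sigma> \<in> L" for \<sigma>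
    proof -
      have "\<sigma> \<inter> (U \<inter> \<Union>L) = \<sigma> \<inter> U" using that by blast
      then show ?thesis using U that assms(1) by (auto simp: openin_realization)
    qed
    then have "openin (realization L) (U \<inter> \<Union>L)" by (auto simp: openin_realization)
    moreover have "{x \<in> topspace (realization L). id x \<in> U} = U \<inter> \<Union>L" by auto
    ultimately show "openin (realization L) {x \<in> topspace (realization L). id x \<in> U}" by simp
  qed
  from connectedin_continuous_map_image[OF this assms(2)] show ?thesis by simp
qed

context full_filtered_complex
begin

lemma stratum_subset: "S \<in> strata F n i \<Longrightarrow> S \<subseteq> level_diff i"
  unfolding strata_def by (drule connected_components_of_subset) simp

lemma level_diff_disjoint:
  assumes "i \<le> n" "j \<le> n" "x \<in> level_diff i" "x \<in> level_diff j"
  shows "i = j"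
proof -
  have *: "\<not> a < b" if "x \<in> level_diff a" "x \<in> level_diff b" "b \<le> n" for a b
  proof
    assume ab: "a < b"
    then obtain j where j: "b = Suc j" "a \<le> j" by (cases b) auto
    then have "F a \<subseteq> F j" using level_mono[of a j] that(3) by simp
    then have "\<Union>(F a) \<subseteq> \<Union>(filt_pred F b)" unfolding j(1) filt_pred_def by (simp add: Union_mono)
    then show False using that(1,2) by blast
  qed
  show ?thesis using *[of i j] *[of j i] assms by linarith
qed

lemma stratum_unique:
  assumes "S \<in> all_strata F n" "S' \<in> all_strata F n" "x \<in> S" "x \<in> S'"
  shows "S = S'"
proof -
  obtain i j where ij: "i \<le> n" "j \<le> n" "S \<in> strata F n i" "S' \<in> strata F n j"
    using assms by (auto simp: all_strata_def)
  have "i = j"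
    by (rule level_diff_disjoint[OF ij(1,2)])
      (use stratum_subset[OF ij(3)] stratum_subset[OF ij(4)] assms(3,4) in auto)
  then have "S' \<in> strata F n i" using ij(4) by simp
  then have "S = S' \<or> disjnt S S'"
    using pairwiseD[OF pairwise_disjoint_connected_components_of] ij(3) unfolding strata_def by metis
  then show ?thesis using assms(3,4) by (auto simp: disjnt_def)
qed

text \<open>
  For \<open>\<sigma> \<in> L\<close> and \<open>\<tau> \<in> F l\<close>, the simplex \<open>\<sigma> \<inter> \<tau>\<close> is a face of both, so it lies in \<open>L \<inter> F l\<close>.
\<close>

lemma Int_level_induced:
  assumes L: "subcomplex L K" and "\<sigma> \<in> L" and "l \<le> n"
  shows "\<sigma> \<inter> \<Union>(L \<inter> F l) = \<sigma> \<inter> \<Union>(F l)"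
proof -
  have "\<exists>\<rho>\<in>L \<inter> F l. x \<in> \<rho>" if x: "x \<in> \<sigma>" "x \<in> \<tau>" "\<tau> \<in> F l" for x \<tau>
  proof -
    have st: "\<sigma> \<in> K" "\<tau> \<in> K"
      using assms x level_subcomplex[OF assms(3)] by (auto dest: subcomplexD)
    then have "(\<sigma> \<inter> \<tau>) face_of \<sigma>" "(\<sigma> \<inter> \<tau>) face_of \<tau>"
      using geom_complexD(3)[OF complex] x by blast+
    then have "\<sigma> \<inter> \<tau> \<in> L \<inter> F l"
      using subcomplexD(2)[OF L assms(2)] subcomplexD(2)[OF level_subcomplex[OF assms(3)] x(3)] x by blast
    then show ?thesis using x by blast
  qed
  then show ?thesis by blast
qed

abbreviation level_diff_in where
  "level_diff_in L i \<equiv> \<Union>(induced_filtration F L i) - \<Union>(filt_pred (induced_filtration F L) i)"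

lemma Int_level_diff_in:
  assumes L: "subcomplex L K" and "\<sigma> \<in> L" and "i \<le> n"
  shows "\<sigma> \<inter> level_diff_in L i = \<sigma> \<inter> level_diff i"
proof -
  have "\<sigma> \<inter> \<Union>(induced_filtration F L i) = \<sigma> \<inter> \<Union>(F i)"
    using Int_level_induced[OF assms] by (simp add: induced_filtration_def)
  moreover have "\<sigma> \<inter> \<Union>(filt_pred (induced_filtration F L) i) = \<sigma> \<inter> \<Union>(filt_pred F i)"
    using Int_level_induced[OF assms(1,2), of "i - 1"] assms(3)
    by (cases i) (auto simp: filt_pred_def induced_filtration_def)
  ultimately show ?thesis by blast
qed

lemma level_diff_in_subset:
  assumes L: "subcomplex L K" and "i \<le> n"
  shows "level_diff_in L i \<subseteq> level_diff i"
proof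
  fix x assume x: "x \<in> level_diff_in L i"
  then obtain \<sigma> where "\<sigma> \<in> L" "x \<in> \<sigma>" by (auto simp: induced_filtration_def)
  with x Int_level_diff_in[OF L _ assms(2)] show "x \<in> level_diff i" by blast
qed

text \<open>
  A non-empty trace of a stratum on a simplex is the trace of the whole difference of consecutive
  filtration terms, since that trace is connected.
\<close>

lemma Int_stratum:
  assumes "\<sigma> \<in> K" "i \<le> n" "S \<in> strata F n i" "\<sigma> \<inter> S \<noteq> {}"
  shows "\<sigma> \<inter> S = \<sigma> \<inter> level_diff i"
proof -
  have "connectedin (subtopology (realization K) (level_diff i)) (\<sigma> \<inter> level_diff i)"
    using connectedin_realization[OF assms(1) connected_Int_level_diff[OF assms(1,2)]]
    by (auto simp: connectedin_subtopology)
  moreover have "\<not> disjnt S (\<sigma> \<inter> level_diff i)"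
    using assms(4) stratum_subset[OF assms(3)] unfolding disjnt_def by blast
  ultimately have "\<sigma> \<inter> level_diff i \<subseteq> S"
    using connected_components_of_maximal assms(3) unfolding strata_def by blast
  then show ?thesis using stratum_subset[OF assms(3)] by blast
qed

text \<open>
  A stratum of a subcomplex is connected in \<open>K\<close> too, so it lies in a stratum of \<open>K\<close>; the latter is
  unique because strata are disjoint. So the induced perversity has the intended value.
\<close>

lemma induced_stratum:
  assumes L: "subcomplex L K" and i: "i \<le> n" and T: "T \<in> strata (induced_filtration F L) n i"
  obtains S where "S \<in> strata F n i" "T \<subseteq> S" "induced_perversity F n p T = p S"
proof -
  have Ln: "induced_filtration F L n = L"
    using subcomplexD(1)[OF L] by (auto simp: induced_filtration_def)
  have ne: "T \<noteq> {}"
    using T nonempty_connected_components_of unfolding strata_def by blast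
  have "connectedin (subtopology (realization L) (level_diff_in L i)) T"
    using T connectedin_connected_components_of unfolding strata_def Ln by blast
  then have "connectedin (realization L) T" "T \<subseteq> level_diff_in L i"
    by (auto simp: connectedin_subtopology)
  then have "connectedin (subtopology (realization K) (level_diff i)) T"
    using connectedin_realization_mono[OF subcomplexD(1)[OF L]] level_diff_in_subset[OF L i]
    by (auto simp: connectedin_subtopology)
  then obtain S where S: "S \<in> strata F n i" "T \<subseteq> S"
    unfolding strata_def using connectedin_subset_component[OF _ ne] by blast
  moreover have "(THE S. S \<in> all_strata F n \<and> T \<subseteq> S) = S"
  proof (rule the_equality)
    show 1: "S \<in> all_strata F n \<and> T \<subseteq> S" using S i by (auto simp: all_strata_def)
    show "S' = S" if "S' \<in> all_strata F n \<and> T \<subseteq> S'" for S'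
      using that 1 ne stratum_unique by blast
  qed
  ultimately show ?thesis using that by (simp add: induced_perversity_def)
qed

text \<open>
  Allowability is intrinsic to the simplex: a simplex of a subcomplex has the same traces on the
  strata of the subcomplex and on those of \<open>K\<close>. Hence the intersection chains of a subcomplex
  are the intersection chains of \<open>K\<close> that are supported in it.
\<close>

lemma induced_allowable_iff:
  assumes L: "subcomplex L K" and s: "\<sigma> \<in> L"
  shows "allowable (induced_filtration F L) n (induced_perversity F n p) \<sigma> \<longleftrightarrow> allowable F n p \<sigma>"
    (is "?l \<longleftrightarrow> ?r")
proof
  assume r: ?r
  show ?l unfolding allowable_def
  proof (intro allI impI ballI)
    fix i T assume i: "i \<le> n" and T: "T \<in> strata (induced_filtration F L) n i"
    obtain S where S: "S \<in> strata F n i" "T \<subseteq> S" "induced_perversity F n p T = p S"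
      using induced_stratum[OF L i T] .
    have "dimension (\<sigma> \<inter> T) \<le> dimension (\<sigma> \<inter> S)" by (rule dimension_mono) (use S in auto)
    also have "\<dots> \<le> ereal (real (sdim \<sigma>) - real (n - i)) + p S"
      using r i S by (auto simp: allowable_def)
    finally show "dimension (\<sigma> \<inter> T) \<le> ereal (real (sdim \<sigma>) - real (n - i)) + induced_perversity F n p T"
      using S by simp
  qed
next
  have sK: "\<sigma> \<in> K" using L s by (auto dest: subcomplexD)
  have Ln: "induced_filtration F L n = L"
    using subcomplexD(1)[OF L] by (auto simp: induced_filtration_def)
  assume l: ?l
  show ?r unfolding allowable_def
  proof (intro allI impI ballI)
    fix i S assume i: "i \<le> n" and S: "S \<in> strata F n i"
    show "dimension (\<sigma> \<inter> S) \<le> ereal (real (sdim \<sigma>) - real (n - i)) + p S"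
    proof (cases "\<sigma> \<inter> S = {}")
      case False
      define D where "D = \<sigma> \<inter> level_diff i"
      have D: "D = \<sigma> \<inter> level_diff_in L i" using Int_level_diff_in[OF L s i] by (simp add: D_def)
      have SD: "\<sigma> \<inter> S = D" using Int_stratum[OF sK i S False] by (simp add: D_def)
      have "connectedin (realization L) D"
        using connectedin_realization[OF s connected_Int_level_diff[OF sK i]] by (simp add: D_def)
      then have "connectedin (subtopology (realization L) (level_diff_in L i)) D"
        using D by (auto simp: connectedin_subtopology)
      then obtain T where T: "T \<in> strata (induced_filtration F L) n i" "D \<subseteq> T"
        unfolding strata_def Ln using connectedin_subset_component False SD by blast
      obtain S' where S': "S' \<in> strata F n i" "T \<subseteq> S'" "induced_perversity F n p T = p S'"
        using induced_stratum[OF L i T(1)] .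
      obtain x where x: "x \<in> \<sigma>" "x \<in> S" using False by blast
      have "x \<in> S'" using x SD T(2) S'(2) by blast
      moreover have "S \<in> all_strata F n" "S' \<in> all_strata F n"
        using S S'(1) i by (auto simp: all_strata_def)
      ultimately have "S' = S" using stratum_unique x(2) by blast
      have "dimension (\<sigma> \<inter> S) \<le> dimension (\<sigma> \<inter> T)" by (rule dimension_mono) (use T SD in auto)
      also have "\<dots> \<le> ereal (real (sdim \<sigma>) - real (n - i)) + p S"
        using l[unfolded allowable_def, rule_format, OF i T(1)] S'(3) \<open>S' = S\<close> by simp
      finally show ?thesis .
    qed auto
  qed
qed

text \<open>
  If \<open>v\<close> belongs to every non-empty term of the filtration, then passing to the face opposite to
  \<open>v\<close> lowers by one the dimension of the simplex and of each non-empty trace on a stratum, so both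
  sides of the allowability inequality drop by one. Removing another vertex may lower the right-hand
  side only.
\<close>

lemma allowable_remove_vertex:
  assumes s: "\<sigma> \<in> K" and al: "allowable F n p \<sigma>" and v: "v \<in> verts \<sigma>"
    and deep: "\<And>i. i \<le> n \<Longrightarrow> F i \<noteq> {} \<Longrightarrow> {v} \<in> F i"
    and ne: "verts \<sigma> - {v} \<noteq> {}"
  shows "allowable F n p (convex hull (verts \<sigma> - {v}))"
  unfolding allowable_def
proof (intro allI impI ballI)
  let ?t = "convex hull (verts \<sigma> - {v})"
  fix i S assume i: "i \<le> n" and S: "S \<in> strata F n i"
  note gs = simplex[OF s]
  note gt = geom_simplex_hull[OF gs Diff_subset ne]
  have t: "?t \<in> K"
    by (rule subcomplex_hull[OF complex subcomplex_refl[OF complex] s]) (use ne in auto)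
  have ts: "?t \<subseteq> \<sigma>"
    using hull_mono[of "verts \<sigma> - {v}" "verts \<sigma>" convex] geom_simplex_verts(4)[OF gs] by auto
  show "dimension (?t \<inter> S) \<le> ereal (real (sdim ?t) - real (n - i)) + p S"
  proof (cases "?t \<inter> S = {}")
    case False
    let ?A = "verts \<sigma> \<inter> filt_verts F i" and ?B = "verts \<sigma> \<inter> filt_verts (filt_pred F) i"
    let ?A' = "(verts \<sigma> - {v}) \<inter> filt_verts F i"
    have "?t \<inter> S = ?t \<inter> level_diff i" using Int_stratum[OF t i S False] .
    then have tS: "?t \<inter> S \<subseteq> convex hull ?A'"
      using Int_level_diff[OF t i] gt(2) by auto
    then have A'ne: "?A' \<noteq> {}" using False by auto
    have sne: "\<sigma> \<inter> S \<noteq> {}" using False ts by blast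
    have sS: "\<sigma> \<inter> S = convex hull ?A - convex hull ?B"
      using Int_stratum[OF s i S sne] Int_level_diff[OF s i] by simp
    have "?B \<noteq> ?A" using sne sS by auto
    then obtain w where w: "w \<in> ?A" "w \<notin> ?B" using filt_verts_pred[OF i] by blast
    have "F i \<noteq> {}" using w by auto
    then have "v \<in> ?A" using deep[OF i] v by auto
    moreover have "?A' = ?A - {v}" by auto
    \<comment> \<open>The face spanned by the vertices in \<open>F i\<close> loses exactly the vertex \<open>v\<close>.\<close>
    ultimately have card: "card ?A = Suc (card ?A')"
      using geom_simplex_verts(1)[OF gs] by (metis card.remove finite_Int)
    have cs: "sdim \<sigma> = Suc (sdim ?t)"
      using card_verts_eq[OF gs] card_verts_eq[OF gt(1)] unfolding gt(2)
      by (metis card.remove[OF geom_simplex_verts(1)[OF gs] v] nat.inject)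
    have "ereal (real (card ?A) - 1) \<le> dimension (\<sigma> \<inter> S)"
      unfolding sS by (rule dimension_hull_Diff_ge[OF gs _ _ w]) (use filt_verts_pred[OF i] in auto)
    also have "\<dots> \<le> ereal (real (sdim \<sigma>) - real (n - i)) + p S"
      using al i S by (auto simp: allowable_def)
    finally have 1: "ereal (real (card ?A) - 1) \<le> ereal (real (sdim \<sigma>) - real (n - i)) + p S" .
    have "dimension (?t \<inter> S) \<le> ereal (real (card ?A') - 1)"
      by (rule dimension_hull_le[OF gs _ A'ne tS]) auto
    also have "\<dots> \<le> ereal (real (sdim ?t) - real (n - i)) + p S"
      using 1 card cs by (cases "p S") auto
    finally show ?thesis .
  qed auto
qed

end

section \<open>Links, stars and clots\<close>

lemma simplex_verts_inject:
  "geom_simplex \<sigma> \<Longrightarrow> geom_simplex \<tau> \<Longrightarrow> verts \<sigma> = verts \<tau> \<Longrightarrow> \<sigma> = \<tau>"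
  by (metis geom_simplex_verts(4))

lemma convex_hull_Un_simplices:
  assumes "geom_simplex \<sigma>" "geom_simplex \<tau>"
  shows "convex hull (\<sigma> \<union> \<tau>) = convex hull (verts \<sigma> \<union> verts \<tau>)"
proof -
  have "convex hull (verts \<sigma> \<union> verts \<tau>) = convex hull (convex hull (verts \<sigma>) \<union> convex hull (verts \<tau>))"
    by (rule hull_Un) (simp add: convex_Inter)
  then show ?thesis
    by (simp add: geom_simplex_verts(4)[OF assms(1)] geom_simplex_verts(4)[OF assms(2)])
qed

text \<open>
  For \<open>\<beta> \<in> K\<close> these are the faces of the simplices that have \<open>\<beta>\<close> as a face. Vertex sets make
  membership a matter of inclusions.
\<close>

definition closed_star :: "'v::real_vector set set \<Rightarrow> 'v set \<Rightarrow> 'v set set" where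
  "closed_star K \<beta> = {\<sigma> \<in> K. \<exists>\<rho>\<in>K. verts \<beta> \<union> verts \<sigma> \<subseteq> verts \<rho>}"

lemma verts_mono_in_complex:
  assumes "geom_complex K" "\<sigma> \<in> K" "\<tau> \<in> K" "\<tau> \<subseteq> \<sigma>"
  shows "verts \<tau> \<subseteq> verts \<sigma>"
proof -
  note s = geom_complexD[OF assms(1,2)] and t = geom_complexD[OF assms(1,3)]
  have "\<tau> \<noteq> {}" using t(1) geom_simplex_nonempty by blast
  moreover have "\<sigma> \<inter> \<tau> = \<tau>" using assms(4) by blast
  ultimately have "\<tau> face_of \<sigma>" using s(3)[OF assms(3)] by simp
  then show ?thesis using face_of_geom_simplex_iff[OF s(1) \<open>\<tau> \<noteq> {}\<close>] by blast
qed

lemma mem_link_iff: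
  assumes K: "geom_complex K" and b: "\<beta> \<in> K"
  shows "\<tau> \<in> link K \<beta> \<longleftrightarrow>
    \<tau> \<in> K \<and> verts \<beta> \<inter> verts \<tau> = {} \<and> (\<exists>\<rho>\<in>K. verts \<rho> = verts \<beta> \<union> verts \<tau>)"
proof
  assume "\<tau> \<in> link K \<beta>"
  then have t: "\<tau> \<in> K" "\<beta> \<inter> \<tau> = {}" "convex hull (\<beta> \<union> \<tau>) \<in> K" by (auto simp: link_def)
  note gs = geom_complexD(1)[OF K b] geom_complexD(1)[OF K t(1)] geom_complexD(1)[OF K t(3)]
  let ?r = "convex hull (\<beta> \<union> \<tau>)"
  have "\<beta> \<subseteq> ?r" "\<tau> \<subseteq> ?r" using hull_subset[of "\<beta> \<union> \<tau>" convex] by auto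
  then have "verts \<beta> \<union> verts \<tau> \<subseteq> verts ?r"
    using verts_mono_in_complex[OF K t(3)] b t(1) by blast
  moreover have "verts ?r \<subseteq> verts \<beta> \<union> verts \<tau>"
    unfolding convex_hull_Un_simplices[OF gs(1,2)]
    using extreme_points_of_convex_hull[of "verts \<beta> \<union> verts \<tau>"] unfolding verts_def[of "convex hull _"] .
  moreover have "verts \<beta> \<inter> verts \<tau> = {}" using t(2) verts_subset by blast
  ultimately show "\<tau> \<in> K \<and> verts \<beta> \<inter> verts \<tau> = {} \<and> (\<exists>\<rho>\<in>K. verts \<rho> = verts \<beta> \<union> verts \<tau>)"
    using t by blast
next
  assume a: "\<tau> \<in> K \<and> verts \<beta> \<inter> verts \<tau> = {} \<and> (\<exists>\<rho>\<in>K. verts \<rho> = verts \<beta> \<union> verts \<tau>)"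
  then obtain \<rho> where r: "\<rho> \<in> K" "verts \<rho> = verts \<beta> \<union> verts \<tau>" by blast
  have gs: "geom_simplex \<beta>" "geom_simplex \<tau>" "geom_simplex \<rho>"
    using geom_complexD(1)[OF K] a b r by auto
  have "convex hull (\<beta> \<union> \<tau>) = \<rho>"
    using convex_hull_Un_simplices[OF gs(1,2)] r(2) geom_simplex_verts(4)[OF gs(3)] by simp
  moreover have "\<beta> \<inter> \<tau> = {}" using complex_Int_hull[OF K b, of \<tau>] a by simp
  ultimately show "\<tau> \<in> link K \<beta>" using a r by (simp add: link_def)
qed

text \<open>
  The join of the link with a set of faces of \<open>\<beta>\<close>, selected by a condition \<open>P\<close> on their vertices:
  a simplex \<open>\<sigma>\<close> of the closed star is the join of the face of \<open>\<beta>\<close> on the vertices shared with \<open>\<beta>\<close>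
  and a simplex of the link, on the remaining vertices. One of the two may be empty, which gives the
  simplices of the link and the faces of \<open>\<beta>\<close>; the simplices of the link are the reason for the
  hypothesis on \<open>P\<close>. The cases \<open>P = True\<close> and \<open>P A = (\<not> verts \<beta> \<subseteq> A)\<close> are
  \<open>\<beta> * L\<^sub>\<beta>\<close> and \<open>\<partial>\<beta> * L\<^sub>\<beta>\<close>.
\<close>

lemma complex_join_link:
  assumes K: "geom_complex K" and b: "\<beta> \<in> K" and P: "P {}"
  shows "complex_join {\<alpha> \<in> faces \<beta>. P (verts \<alpha>)} (link K \<beta>) =
    {\<sigma> \<in> closed_star K \<beta>. P (verts \<beta> \<inter> verts \<sigma>)}" (is "?J = ?R")
proof
  note gb = geom_complexD(1)[OF K b]
  note Krefl = subcomplex_refl[OF K]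
  have face: "\<alpha> \<in> K \<and> verts \<alpha> \<subseteq> verts \<beta>" if "\<alpha> \<in> faces \<beta>" for \<alpha>
    using that geom_complexD(2)[OF K b] face_of_geom_simplex_iff[OF gb] by (auto simp: faces_def)
  show "?J \<subseteq> ?R"
  proof
    fix \<sigma> assume "\<sigma> \<in> ?J"
    then consider "\<sigma> \<in> faces \<beta>" "P (verts \<sigma>)" | "\<sigma> \<in> link K \<beta>"
      | \<alpha> \<tau> where "\<alpha> \<in> faces \<beta>" "P (verts \<alpha>)" "\<tau> \<in> link K \<beta>" "\<sigma> = convex hull (\<alpha> \<union> \<tau>)"
      by (auto simp: complex_join_def)
    then show "\<sigma> \<in> ?R"
    proof cases
      case 1
      then have "verts \<beta> \<inter> verts \<sigma> = verts \<sigma>" using face by blast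
      then show ?thesis using 1 face[OF 1(1)] b by (auto simp: closed_star_def)
    next
      case 2
      then show ?thesis using P by (auto simp: mem_link_iff[OF K b] closed_star_def)
    next
      case 3
      obtain \<rho> where r: "\<rho> \<in> K" "verts \<rho> = verts \<beta> \<union> verts \<tau>" "verts \<beta> \<inter> verts \<tau> = {}" "\<tau> \<in> K"
        using 3(3) by (auto simp: mem_link_iff[OF K b])
      note a = face[OF 3(1)]
      note g = geom_complexD(1)[OF K conjunct1[OF a]] geom_complexD(1)[OF K r(4)] geom_complexD(1)[OF K r(1)]
      have ne: "verts \<alpha> \<union> verts \<tau> \<noteq> {}" and sub: "verts \<alpha> \<union> verts \<tau> \<subseteq> verts \<rho>"
        using geom_simplex_verts(2)[OF g(2)] a r(2) by auto
      have s: "\<sigma> = convex hull (verts \<alpha> \<union> verts \<tau>)"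
        using 3(4) convex_hull_Un_simplices[OF g(1,2)] by simp
      have sK: "\<sigma> \<in> K" unfolding s by (rule subcomplex_hull[OF K Krefl r(1) sub ne])
      have vs: "verts \<sigma> = verts \<alpha> \<union> verts \<tau>" unfolding s by (rule geom_simplex_hull[OF g(3) sub ne])
      have "verts \<beta> \<inter> verts \<sigma> = verts \<alpha>" using vs a r(3) by blast
      moreover have "verts \<beta> \<union> verts \<sigma> \<subseteq> verts \<rho>" using vs a r(2) by blast
      ultimately show ?thesis using 3(2) sK r(1) by (auto simp: closed_star_def)
    qed
  qed
  show "?R \<subseteq> ?J"
  proof
    fix \<sigma> assume "\<sigma> \<in> ?R"
    then obtain \<rho> where s: "\<sigma> \<in> K" "P (verts \<beta> \<inter> verts \<sigma>)" and r: "\<rho> \<in> K" "verts \<beta> \<union> verts \<sigma> \<subseteq> verts \<rho>"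
      by (auto simp: closed_star_def)
    let ?A = "verts \<beta> \<inter> verts \<sigma>" and ?B = "verts \<sigma> - verts \<beta>"
    note gs = geom_complexD(1)[OF K s(1)] and gr = geom_complexD(1)[OF K r(1)]
    have A: "convex hull ?A \<in> {\<alpha> \<in> faces \<beta>. P (verts \<alpha>)}" "verts (convex hull ?A) = ?A" "geom_simplex (convex hull ?A)"
      if "?A \<noteq> {}"
    proof -
      have g: "geom_simplex (convex hull ?A)" "verts (convex hull ?A) = ?A"
        by (rule geom_simplex_hull[OF gs]; use that in auto)+
      then have "convex hull ?A face_of \<beta>" using face_of_geom_simplex_iff[OF gb] that by auto
      then show "convex hull ?A \<in> {\<alpha> \<in> faces \<beta>. P (verts \<alpha>)}" "verts (convex hull ?A) = ?A" "geom_simplex (convex hull ?A)"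
        using g s(2) that by (auto simp: faces_def)
    qed
    have B: "convex hull ?B \<in> link K \<beta>" "verts (convex hull ?B) = ?B" "geom_simplex (convex hull ?B)" if "?B \<noteq> {}"
    proof -
      have g: "geom_simplex (convex hull ?B)" "verts (convex hull ?B) = ?B"
        by (rule geom_simplex_hull[OF gs]; use that in auto)+
      have "convex hull ?B \<in> K" by (rule subcomplex_hull[OF K Krefl s(1)]) (use that in auto)
      moreover have "convex hull (verts \<beta> \<union> ?B) \<in> K"
        by (rule subcomplex_hull[OF K Krefl r(1)]) (use that r in auto)
      moreover have "verts (convex hull (verts \<beta> \<union> ?B)) = verts \<beta> \<union> ?B"
        by (rule geom_simplex_hull[OF gr]) (use that r in auto)
      ultimately show "convex hull ?B \<in> link K \<beta>" "verts (convex hull ?B) = ?B" "geom_simplex (convex hull ?B)"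
        using g mem_link_iff[OF K b] by auto
    qed
    have AB: "?A \<union> ?B = verts \<sigma>" by blast
    have s_hull: "\<sigma> = convex hull (verts \<sigma>)" using geom_simplex_verts(4)[OF gs] by simp
    show "\<sigma> \<in> ?J"
    proof (cases "?A = {}")
      case True
      then have "?B = verts \<sigma>" by blast
      then have "\<sigma> \<in> link K \<beta>" using B(1) geom_simplex_verts(2)[OF gs] s_hull by simp
      then show ?thesis by (simp add: complex_join_def)
    next
      case Ane: False
      show ?thesis
      proof (cases "?B = {}")
        case True
        then have "?A = verts \<sigma>" by blast
        then have "\<sigma> \<in> {\<alpha> \<in> faces \<beta>. P (verts \<alpha>)}" using A(1)[OF Ane] s_hull by simp
        then show ?thesis by (simp add: complex_join_def)
      next
        case False
        have "\<sigma> = convex hull (convex hull ?A \<union> convex hull ?B)"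
          unfolding convex_hull_Un_simplices[OF A(3)[OF Ane] B(3)[OF False]] A(2)[OF Ane] B(2)[OF False] AB
          by (rule s_hull)
        then show ?thesis using A(1)[OF Ane] B(1)[OF False] unfolding complex_join_def by blast
      qed
    qed
  qed
qed

lemma complex_join_faces_link:
  assumes "geom_complex K" "\<beta> \<in> K"
  shows "complex_join (faces \<beta>) (link K \<beta>) = closed_star K \<beta>"
  using complex_join_link[OF assms, of "\<lambda>_. True"] by simp

lemma complex_join_boundary_link:
  assumes K: "geom_complex K" and b: "\<beta> \<in> K"
  shows "complex_join (boundary_complex \<beta>) (link K \<beta>) =
    {\<sigma> \<in> closed_star K \<beta>. \<not> verts \<beta> \<subseteq> verts \<sigma>}"
proof -
  note gb = geom_complexD(1)[OF K b]
  have "boundary_complex \<beta> = {\<alpha> \<in> faces \<beta>. \<not> verts \<beta> \<subseteq> verts \<alpha>}"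
  proof (rule Set.set_eqI)
    fix \<alpha>
    show "\<alpha> \<in> boundary_complex \<beta> \<longleftrightarrow> \<alpha> \<in> {\<alpha> \<in> faces \<beta>. \<not> verts \<beta> \<subseteq> verts \<alpha>}"
    proof (cases "\<alpha> \<in> faces \<beta>")
      case True
      then have "geom_simplex \<alpha>" "verts \<alpha> \<subseteq> verts \<beta>"
        using face_of_geom_simplex_iff[OF gb, of \<alpha>] by (auto simp: faces_def)
      then have "\<alpha> = \<beta> \<longleftrightarrow> verts \<beta> \<subseteq> verts \<alpha>" using simplex_verts_inject[OF gb] by blast
      then show ?thesis using True by (simp add: boundary_complex_def faces_def)
    qed (auto simp: boundary_complex_def faces_def)
  qed
  moreover have "verts \<beta> \<noteq> {}" using geom_simplex_verts(2)[OF gb] .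
  moreover have "verts \<beta> \<subseteq> verts \<beta> \<inter> A \<longleftrightarrow> verts \<beta> \<subseteq> A" for A by blast
  ultimately show ?thesis
    using complex_join_link[OF K b, of "\<lambda>A. \<not> verts \<beta> \<subseteq> A"] by simp
qed

lemma subcomplexI:
  assumes K: "geom_complex K" and "L \<subseteq> K"
    and "\<And>\<sigma> \<tau>. \<sigma> \<in> L \<Longrightarrow> \<tau> \<in> K \<Longrightarrow> verts \<tau> \<subseteq> verts \<sigma> \<Longrightarrow> \<tau> \<in> L"
  shows "subcomplex L K"
  unfolding subcomplex_def
proof (intro conjI ballI allI impI)
  fix \<sigma> \<tau> assume "\<sigma> \<in> L" and t: "\<tau> face_of \<sigma> \<and> \<tau> \<noteq> {}"
  then have s: "\<sigma> \<in> K" using assms(2) by blast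
  note geom_complexD[OF K s]
  then show "\<tau> \<in> L" using assms(3)[OF \<open>\<sigma> \<in> L\<close>, of \<tau>] face_of_geom_simplex_iff[of \<sigma> \<tau>] t by blast
qed fact

lemma subcomplex_closed_star:
  assumes "geom_complex K"
  shows "subcomplex (closed_star K \<beta>) K"
    and "subcomplex {\<sigma> \<in> closed_star K \<beta>. \<not> verts \<beta> \<subseteq> verts \<sigma>} K"
  by (rule subcomplexI[OF assms]; auto simp: closed_star_def; blast)+

locale nonempty_full_filtered_complex = full_filtered_complex +
  assumes nonempty: "F n \<noteq> {}"
begin

text \<open>
  The index of the first non-empty term of the filtration, of which the clots are the simplices of
  largest dimension.
\<close>

definition lowest where "lowest = n - comp_a F n"

lemma lowest: "lowest \<le> n" "F lowest \<noteq> {}" "\<And>i. i \<le> n \<Longrightarrow> F i \<noteq> {} \<Longrightarrow> lowest \<le> i"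
proof -
  let ?S = "{k \<in> {0..n}. F (n - k) \<noteq> {}}"
  have "finite ?S" "0 \<in> ?S" using nonempty by auto
  then have M: "comp_a F n \<in> ?S" unfolding comp_a_def by (intro Max_in) auto
  then show "lowest \<le> n" "F lowest \<noteq> {}" by (auto simp: lowest_def)
  fix i assume "i \<le> n" "F i \<noteq> {}"
  then have "n - i \<in> ?S" by auto
  then have "n - i \<le> comp_a F n" unfolding comp_a_def using \<open>finite ?S\<close> by (rule Max_ge[rotated])
  then show "lowest \<le> i" by (simp add: lowest_def)
qed

lemma lowest_subset: "i \<le> n \<Longrightarrow> F i \<noteq> {} \<Longrightarrow> F lowest \<subseteq> F i"
  using level_mono lowest(3) by blast

abbreviation core where "core \<sigma> \<equiv> verts \<sigma> \<inter> filt_verts F lowest"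

lemma clotsD:
  assumes "\<beta> \<in> clots F n"
  shows "\<beta> \<in> F lowest" "\<beta> \<in> K" "ereal (real (sdim \<beta>)) = comp_b F n" "verts \<beta> \<subseteq> filt_verts F lowest"
proof -
  note l = level_subcomplex[OF lowest(1)]
  show b: "\<beta> \<in> F lowest" "ereal (real (sdim \<beta>)) = comp_b F n"
    using assms by (auto simp: clots_def lowest_def)
  then show "\<beta> \<in> K" using l by (auto dest: subcomplexD)
  show "verts \<beta> \<subseteq> filt_verts F lowest"
    using subcomplex_hull[OF complex l b(1), of "{_}"] by auto
qed

lemma sdim_le_comp_b: "\<tau> \<in> F lowest \<Longrightarrow> ereal (real (sdim \<tau>)) \<le> comp_b F n"
  unfolding comp_b_def complex_dim_def lowest_def by (rule SUP_upper)

lemma core_simplex: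
  assumes s: "\<sigma> \<in> K" and c: "core \<sigma> \<noteq> {}"
  shows "convex hull (core \<sigma>) \<in> F lowest" "verts (convex hull (core \<sigma>)) = core \<sigma>"
    "geom_simplex (convex hull (core \<sigma>))"
proof -
  show v: "verts (convex hull (core \<sigma>)) = core \<sigma>" "geom_simplex (convex hull (core \<sigma>))"
    by (rule geom_simplex_hull[OF simplex[OF s]]; use c in auto)+
  have "convex hull (core \<sigma>) \<in> K"
    by (rule subcomplex_hull[OF complex subcomplex_refl[OF complex] s]) (use c in auto)
  then show "convex hull (core \<sigma>) \<in> F lowest"
    using full lowest(1) v unfolding full_filtration_def by blast
qed

text \<open>
  The vertices of \<open>\<sigma>\<close> in the lowest term span a simplex of it, of dimension at most that of a clot.
  So a clot that is a face of \<open>\<sigma>\<close> exhausts them.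
\<close>

lemma clot_eq_core:
  assumes s: "\<sigma> \<in> K" and b: "\<beta> \<in> clots F n" and sub: "verts \<beta> \<subseteq> verts \<sigma>"
  shows "verts \<beta> = core \<sigma>"
proof -
  note bD = clotsD[OF b]
  note gb = simplex[OF bD(2)]
  have bc: "verts \<beta> \<subseteq> core \<sigma>" using sub bD(4) by blast
  then have c: "core \<sigma> \<noteq> {}" using geom_simplex_verts(2)[OF gb] by blast
  note cs = core_simplex[OF s c]
  have "ereal (real (sdim (convex hull (core \<sigma>)))) \<le> ereal (real (sdim \<beta>))"
    using sdim_le_comp_b[OF cs(1)] bD(3) by simp
  then have "card (core \<sigma>) \<le> card (verts \<beta>)"
    using card_verts_eq[OF cs(3)] card_verts_eq[OF gb] cs(2) by simp
  then show ?thesis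
    using bc geom_simplex_verts(1)[OF simplex[OF s]] by (intro card_seteq) auto
qed

lemma clot_unique:
  assumes "\<sigma> \<in> K" "\<beta> \<in> clots F n" "verts \<beta> \<subseteq> verts \<sigma>" "\<beta>' \<in> clots F n" "verts \<beta>' \<subseteq> verts \<sigma>"
  shows "\<beta> = \<beta>'"
proof (rule simplex_verts_inject)
  show "geom_simplex \<beta>" "geom_simplex \<beta>'" using simplex clotsD(2) assms(2,4) by blast+
  show "verts \<beta> = verts \<beta>'"
    using clot_eq_core[OF assms(1-3)] clot_eq_core[OF assms(1,4,5)] by simp
qed

text \<open>
  The simplices outside the residual complex are those having a clot as a face, and by uniqueness of
  that clot they are partitioned by the clots. If the lowest term has infinite dimension, there are
  no clots and the residual complex is everything.
\<close>

lemma mem_residual_iff: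
  assumes s: "\<sigma> \<in> K"
  shows "\<sigma> \<in> residual F n \<longleftrightarrow> \<not> (\<exists>\<beta>\<in>clots F n. verts \<beta> \<subseteq> verts \<sigma>)"
proof -
  have res: "\<sigma> \<in> residual F n \<longleftrightarrow> dimension (convex hull (core \<sigma>)) < comp_b F n"
    using Int_level[OF s lowest(1)] s by (simp add: residual_def lowest_def)
  show ?thesis
  proof (cases "core \<sigma> = {}")
    case True
    \<comment> \<open>The empty intersection has dimension \<open>-\<infinity>\<close>, which is below the dimension of any non-empty complex.\<close>
    obtain \<tau> where "\<tau> \<in> F lowest" using lowest(2) by blast
    then have "- \<infinity> < comp_b F n" using sdim_le_comp_b[of \<tau>] by (metis MInfty_neq_ereal(2) ereal_infty_less(2) ereal_infty_less_eq(2))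
    moreover have "\<not> verts \<beta> \<subseteq> verts \<sigma>" if "\<beta> \<in> clots F n" for \<beta>
      using that clotsD[OF that] True geom_simplex_verts(2)[OF simplex] by blast
    ultimately show ?thesis using res True by auto
  next
    case False
    note cs = core_simplex[OF s False]
    have eq: "\<sigma> \<in> residual F n \<longleftrightarrow> ereal (real (sdim (convex hull (core \<sigma>)))) < comp_b F n"
      using res dimension_geom_simplex[OF cs(3)] by simp
    show ?thesis
    proof
      assume r: "\<sigma> \<in> residual F n"
      show "\<not> (\<exists>\<beta>\<in>clots F n. verts \<beta> \<subseteq> verts \<sigma>)"
      proof
        assume "\<exists>\<beta>\<in>clots F n. verts \<beta> \<subseteq> verts \<sigma>"
        then obtain \<beta> where b: "\<beta> \<in> clots F n" "verts \<beta> \<subseteq> verts \<sigma>" by blast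
        then have "verts \<beta> = core \<sigma>" using clot_eq_core[OF s] by blast
        then have "sdim (convex hull (core \<sigma>)) = sdim \<beta>" using cs(2) by (simp add: sdim_def)
        then show False using r eq clotsD(3)[OF b(1)] by simp
      qed
    next
      assume n: "\<not> (\<exists>\<beta>\<in>clots F n. verts \<beta> \<subseteq> verts \<sigma>)"
      have "convex hull (core \<sigma>) \<notin> clots F n" using n cs(2) by auto
      then have "ereal (real (sdim (convex hull (core \<sigma>)))) \<noteq> comp_b F n"
        using cs(1) by (simp add: clots_def lowest_def)
      then show "\<sigma> \<in> residual F n" using eq sdim_le_comp_b[OF cs(1)] by simp
    qed
  qed
qed

lemma subcomplex_residual: "subcomplex (residual F n) K"
proof (rule subcomplexI[OF complex])
  show "residual F n \<subseteq> K" by (auto simp: residual_def)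
  then show "\<tau> \<in> residual F n" if "\<sigma> \<in> residual F n" "\<tau> \<in> K" "verts \<tau> \<subseteq> verts \<sigma>" for \<sigma> \<tau>
    using that mem_residual_iff[of \<sigma>] mem_residual_iff[of \<tau>] by blast
qed

lemma allowable_remove_clot_vertex:
  assumes s: "\<sigma> \<in> K" and al: "allowable F n p \<sigma>" and b: "\<beta> \<in> clots F n"
    and v: "v \<in> verts \<beta>" "v \<in> verts \<sigma>" and ne: "verts \<sigma> - {v} \<noteq> {}"
  shows "allowable F n p (convex hull (verts \<sigma> - {v}))"
proof (rule allowable_remove_vertex[OF s al v(2) _ ne])
  fix i assume "i \<le> n" "F i \<noteq> {}"
  then show "{v} \<in> F i" using lowest_subset clotsD(4)[OF b] v(1) by blast
qed

end

section \<open>Direct sums and quotients of chain complexes\<close>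

lemma hom_gfinprod:
  assumes G: "comm_group G" and H: "comm_group H" and h: "h \<in> hom G H"
    and f: "f \<in> I \<rightarrow> carrier G" and fin: "finite {i \<in> I. f i \<noteq> \<one>\<^bsub>G\<^esub>}"
  shows "h (gfinprod G f I) = gfinprod H (\<lambda>i. h (f i)) I"
proof -
  interpret G: comm_group G by fact
  interpret H: comm_group H by fact
  interpret h: group_hom G H h by unfold_locales fact
  let ?S = "{i \<in> I. f i \<noteq> \<one>\<^bsub>G\<^esub>}"
  have "h (finprod G f S) = finprod H (\<lambda>i. h (f i)) S" if "finite S" "S \<subseteq> I" for S
    using that
  proof (induction S)
    case (insert i S)
    then have "f \<in> S \<rightarrow> carrier G" "f i \<in> carrier G" using f by auto
    moreover from this have "(\<lambda>i. h (f i)) \<in> S \<rightarrow> carrier H" by (intro funcsetI h.hom_closed) auto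
    ultimately show ?case using insert by simp
  qed simp
  from this[OF fin] have 1: "h (finprod G f ?S) = finprod H (\<lambda>i. h (f i)) ?S" by auto
  have hf: "(\<lambda>i. h (f i)) \<in> I \<rightarrow> carrier H" using f by (intro funcsetI h.hom_closed) auto
  have "gfinprod H (\<lambda>i. h (f i)) I = gfinprod H (\<lambda>i. h (f i)) ?S"
    by (rule H.gfinprod_mono_neutral_cong_right) (use hf in auto)
  also have "\<dots> = finprod H (\<lambda>i. h (f i)) ?S"
    by (rule H.gfinprod_eq_finprod) (use hf fin in auto)
  finally show ?thesis using 1 fin by (simp add: gfinprod_def)
qed

text \<open>
  Recognition of a direct sum: if the maps \<open>\<psi> i\<close> are the coordinates of the images of the maps \<open>e i\<close>,
  are locally finite and are jointly injective, then \<open>Q\<close> is the direct sum of the \<open>P i\<close>.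
\<close>

lemma sum_of_homs_iso:
  assumes Q: "comm_group Q" and P: "\<And>i. i \<in> I \<Longrightarrow> comm_group (P i)"
    and e: "\<And>i. i \<in> I \<Longrightarrow> e i \<in> hom (P i) Q" and \<psi>: "\<And>i. i \<in> I \<Longrightarrow> \<psi> i \<in> hom Q (P i)"
    and diag: "\<And>i x. i \<in> I \<Longrightarrow> x \<in> carrier (P i) \<Longrightarrow> \<psi> i (e i x) = x"
    and off: "\<And>i j x. i \<in> I \<Longrightarrow> j \<in> I \<Longrightarrow> i \<noteq> j \<Longrightarrow> x \<in> carrier (P i) \<Longrightarrow> \<psi> j (e i x) = \<one>\<^bsub>P j\<^esub>"
    and fin: "\<And>x. x \<in> carrier Q \<Longrightarrow> finite {i \<in> I. \<psi> i x \<noteq> \<one>\<^bsub>P i\<^esub>}"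
    and ker: "\<And>x. x \<in> carrier Q \<Longrightarrow> (\<And>i. i \<in> I \<Longrightarrow> \<psi> i x = \<one>\<^bsub>P i\<^esub>) \<Longrightarrow> x = \<one>\<^bsub>Q\<^esub>"
  shows "(\<lambda>f. gfinprod Q (\<lambda>i. e i (f i)) I) \<in> iso (sum_group I P) Q"
proof -
  interpret Q: comm_group Q by fact
  have gP: "group (P i)" if "i \<in> I" for i using P[OF that] by (simp add: comm_group_def)
  let ?\<phi> = "\<lambda>f. gfinprod Q (\<lambda>i. e i (f i)) I"
  let ?\<Psi> = "\<lambda>x. \<lambda>i\<in>I. \<psi> i x"
  have hom: "?\<phi> \<in> hom (sum_group I P) Q" by (rule Q.hom_group_sum[OF e gP])
  \<comment> \<open>\<open>?\<Psi>\<close> is a left inverse of \<open>?\<phi>\<close> and is injective, so the two are mutually inverse.\<close>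
  have \<Psi>\<phi>: "?\<Psi> (?\<phi> f) = f" if f: "f \<in> carrier (sum_group I P)" for f
  proof
    fix j
    have fP: "f \<in> (\<Pi>\<^sub>E i\<in>I. carrier (P i))" and ff: "finite {i \<in> I. f i \<noteq> \<one>\<^bsub>P i\<^esub>}"
      using f by (auto simp: carrier_sum_group gP)
    show "?\<Psi> (?\<phi> f) j = f j"
    proof (cases "j \<in> I")
      case True
      interpret Pj: comm_group "P j" by (rule P[OF True])
      have ef: "(\<lambda>i. e i (f i)) \<in> I \<rightarrow> carrier Q"
        using fP hom_in_carrier[OF e] by (auto simp: PiE_iff)
      have "finite {i \<in> I. e i (f i) \<noteq> \<one>\<^bsub>Q\<^esub>}"
        by (rule rev_finite_subset[OF ff]) (use hom_one[OF e gP Q.is_group] in auto)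
      then have "\<psi> j (?\<phi> f) = gfinprod (P j) (\<lambda>i. \<psi> j (e i (f i))) I"
        by (rule hom_gfinprod[OF Q P[OF True] \<psi>[OF True] ef])
      also have "\<dots> = gfinprod (P j) (\<lambda>i. \<psi> j (e i (f i))) {j}"
      proof (rule Pj.gfinprod_mono_neutral_cong_right)
        show "\<psi> j (e i (f i)) = \<one>\<^bsub>P j\<^esub>" if "i \<in> I - {j}" for i
          using off[of i j "f i"] that True fP by (auto simp: PiE_iff)
        show "(\<lambda>i. \<psi> j (e i (f i))) \<in> I \<rightarrow> carrier (P j)"
          using ef hom_in_carrier[OF \<psi>[OF True]] by auto
      qed (use True in auto)
      also have "\<dots> = f j"
        using diag[OF True, of "f j"] True fP by (auto simp: PiE_iff)
      finally show ?thesis using True by simp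
    qed (use fP in \<open>auto simp: PiE_iff extensional_def\<close>)
  qed
  have \<Psi>Q: "?\<Psi> x \<in> carrier (sum_group I P)" if x: "x \<in> carrier Q" for x
  proof -
    have "{i \<in> I. ?\<Psi> x i \<noteq> \<one>\<^bsub>P i\<^esub>} = {i \<in> I. \<psi> i x \<noteq> \<one>\<^bsub>P i\<^esub>}" by auto
    then show ?thesis
      using x hom_in_carrier[OF \<psi>] fin[OF x] by (auto simp: carrier_sum_group gP)
  qed
  have inj: "x = y" if x: "x \<in> carrier Q" and y: "y \<in> carrier Q" and eq: "?\<Psi> x = ?\<Psi> y" for x y
  proof -
    have "x \<otimes>\<^bsub>Q\<^esub> inv\<^bsub>Q\<^esub> y = \<one>\<^bsub>Q\<^esub>"
    proof (rule ker)
      fix i assume i: "i \<in> I"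
      interpret \<psi>: group_hom Q "P i" "\<psi> i"
        by (intro group_hom.intro Q.is_group gP i group_hom_axioms.intro \<psi>)
      have "\<psi> i x = \<psi> i y" using fun_cong[OF eq, of i] i by simp
      then show "\<psi> i (x \<otimes>\<^bsub>Q\<^esub> inv\<^bsub>Q\<^esub> y) = \<one>\<^bsub>P i\<^esub>" using x y by simp
    qed (use x y in auto)
    then show ?thesis using x y by (metis Q.inv_closed Q.inv_equality Q.inv_inv)
  qed
  have "bij_betw ?\<phi> (carrier (sum_group I P)) (carrier Q)"
  proof (rule bij_betw_byWitness[where f' = ?\<Psi>])
    show "\<forall>a\<in>carrier (sum_group I P). ?\<Psi> (?\<phi> a) = a" using \<Psi>\<phi> by blast
    show \<phi>Q: "?\<phi> ` carrier (sum_group I P) \<subseteq> carrier Q"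
      using hom by (auto simp only: hom_def)
    show "\<forall>x\<in>carrier Q. ?\<phi> (?\<Psi> x) = x"
    proof
      fix x assume x: "x \<in> carrier Q"
      show "?\<phi> (?\<Psi> x) = x"
      proof (rule inj)
        show "?\<phi> (?\<Psi> x) \<in> carrier Q" using \<phi>Q \<Psi>Q[OF x] by blast
        show "?\<Psi> (?\<phi> (?\<Psi> x)) = ?\<Psi> x" by (rule \<Psi>\<phi>[OF \<Psi>Q[OF x]])
      qed fact
    qed
    show "?\<Psi> ` carrier Q \<subseteq> carrier (sum_group I P)" using \<Psi>Q by blast
  qed
  with hom show ?thesis unfolding iso_def by blast
qed

text \<open>
  The set \<open>M <#>\<^bsub>H\<^esub> h ` X\<close> is the image of the coset \<open>X\<close> under the map of quotients induced by
  \<open>h\<close>, written without a representative. For \<open>h\<close> an inclusion or a differential it occurs in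
  \<^const>\<open>sum_of_inclusions\<close> and in \<^const>\<open>quotient_complex\<close>.
\<close>

lemma induced_coset:
  assumes G: "comm_group G" and H: "comm_group H" and h: "h \<in> hom G H"
    and N: "subgroup N G" and M: "subgroup M H" and sub: "h ` N \<subseteq> M" and x: "x \<in> carrier G"
  shows "M <#>\<^bsub>H\<^esub> h ` (N #>\<^bsub>G\<^esub> x) = M #>\<^bsub>H\<^esub> h x"
proof -
  interpret G: comm_group G by fact
  interpret H: comm_group H by fact
  interpret h: group_hom G H h by unfold_locales fact
  interpret N: subgroup N G by fact
  interpret M: subgroup M H by fact
  show ?thesis
  proof
    show "M <#>\<^bsub>H\<^esub> h ` (N #>\<^bsub>G\<^esub> x) \<subseteq> M #>\<^bsub>H\<^esub> h x"
    proof
      fix z assume "z \<in> M <#>\<^bsub>H\<^esub> h ` (N #>\<^bsub>G\<^esub> x)"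
      then obtain m k where z: "m \<in> M" "k \<in> N" "z = m \<otimes>\<^bsub>H\<^esub> h (k \<otimes>\<^bsub>G\<^esub> x)"
        by (auto simp: set_mult_def r_coset_def)
      have "h k \<in> M" using sub z by blast
      then have "z = (m \<otimes>\<^bsub>H\<^esub> h k) \<otimes>\<^bsub>H\<^esub> h x" "m \<otimes>\<^bsub>H\<^esub> h k \<in> M"
        using z x by (auto simp: H.m_assoc)
      then show "z \<in> M #>\<^bsub>H\<^esub> h x" by (auto simp: r_coset_def)
    qed
    show "M #>\<^bsub>H\<^esub> h x \<subseteq> M <#>\<^bsub>H\<^esub> h ` (N #>\<^bsub>G\<^esub> x)"
    proof
      fix z assume "z \<in> M #>\<^bsub>H\<^esub> h x"
      then obtain m where "m \<in> M" "z = m \<otimes>\<^bsub>H\<^esub> h x" by (auto simp: r_coset_def)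
      then show "z \<in> M <#>\<^bsub>H\<^esub> h ` (N #>\<^bsub>G\<^esub> x)"
        using G.rcos_self[OF x N] unfolding set_mult_def by blast
    qed
  qed
qed

lemma induced_hom:
  assumes G: "comm_group G" and H: "comm_group H" and h: "h \<in> hom G H"
    and N: "subgroup N G" and M: "subgroup M H" and sub: "h ` N \<subseteq> M"
  shows "(\<lambda>X. M <#>\<^bsub>H\<^esub> h ` X) \<in> hom (G Mod N) (H Mod M)"
proof (rule homI)
  interpret G: comm_group G by fact
  interpret H: comm_group H by fact
  have Nn: "N \<lhd> G" and Mn: "M \<lhd> H"
    using N M G.normal_iff_subgroup H.normal_iff_subgroup by auto
  fix X assume "X \<in> carrier (G Mod N)"
  then obtain x where x: "x \<in> carrier G" "X = N #>\<^bsub>G\<^esub> x" by (auto simp: carrier_FactGroup)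
  note hx = hom_in_carrier[OF h x(1)]
  show "M <#>\<^bsub>H\<^esub> h ` X \<in> carrier (H Mod M)"
    unfolding x(2) induced_coset[OF assms x(1)] carrier_FactGroup using hx by blast
  fix Y assume "Y \<in> carrier (G Mod N)"
  then obtain y where y: "y \<in> carrier G" "Y = N #>\<^bsub>G\<^esub> y" by (auto simp: carrier_FactGroup)
  note hy = hom_in_carrier[OF h y(1)]
  show "M <#>\<^bsub>H\<^esub> h ` (X \<otimes>\<^bsub>G Mod N\<^esub> Y) = (M <#>\<^bsub>H\<^esub> h ` X) \<otimes>\<^bsub>H Mod M\<^esub> (M <#>\<^bsub>H\<^esub> h ` Y)"
    using induced_coset[OF assms x(1)] induced_coset[OF assms y(1)]
      induced_coset[OF assms G.m_closed[OF x(1) y(1)]]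
    by (simp add: x(2) y(2) normal.rcos_sum[OF Nn x(1) y(1)] normal.rcos_sum[OF Mn hx hy]
        hom_mult[OF h x(1) y(1)])
qed

lemma is_chain_complexD:
  assumes "is_chain_complex C"
  shows "comm_group (grp C q)" "diff C q \<in> hom (grp C (Suc q)) (grp C q)"
    "x \<in> carrier (grp C (Suc (Suc q))) \<Longrightarrow> diff C q (diff C (Suc q) x) = \<one>\<^bsub>grp C q\<^esub>"
  using assms by (auto simp: is_chain_complex_def)

lemma chain_subcomplexD:
  assumes "chain_subcomplex D C"
  shows "is_chain_complex D" "is_chain_complex C" "subgroup (carrier (grp D q)) (grp C q)"
    "(\<lambda>x. x) \<in> hom (grp D q) (grp C q)"
    "diff C q ` carrier (grp D (Suc q)) \<subseteq> carrier (grp D q)"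
    "x \<in> carrier (grp D (Suc q)) \<Longrightarrow> diff D q x = diff C q x"
proof -
  show D: "is_chain_complex D" "is_chain_complex C" "subgroup (carrier (grp D q)) (grp C q)"
    and d: "x \<in> carrier (grp D (Suc q)) \<Longrightarrow> diff D q x = diff C q x"
    using assms by (auto simp: chain_subcomplex_def)
  show "(\<lambda>x. x) \<in> hom (grp D q) (grp C q)"
    using assms subgroup.subset[OF D(3)] unfolding chain_subcomplex_def hom_def by auto
  show "diff C q ` carrier (grp D (Suc q)) \<subseteq> carrier (grp D q)"
    using assms hom_in_carrier[OF is_chain_complexD(2)[OF D(1)]] unfolding chain_subcomplex_def
    by (metis image_subsetI)
qed

lemma quotient_complex_grp [simp]:
  "grp (quotient_complex C D) q = grp C q Mod carrier (grp D q)"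
  by (simp add: quotient_complex_def)

lemma diff_quotient_complex:
  assumes D: "chain_subcomplex D C" and x: "x \<in> carrier (grp C (Suc q))"
  shows "diff (quotient_complex C D) q (carrier (grp D (Suc q)) #>\<^bsub>grp C (Suc q)\<^esub> x) =
    carrier (grp D q) #>\<^bsub>grp C q\<^esub> diff C q x"
  using induced_coset[OF is_chain_complexD(1) is_chain_complexD(1) is_chain_complexD(2)
      chain_subcomplexD(3)[OF D] chain_subcomplexD(3)[OF D] chain_subcomplexD(5)[OF D] x]
    chain_subcomplexD(2)[OF D] by (simp add: quotient_complex_def)

lemma is_chain_complex_quotient:
  assumes D: "chain_subcomplex D C"
  shows "is_chain_complex (quotient_complex C D)"
  unfolding is_chain_complex_def
proof (intro conjI allI ballI)
  note C = is_chain_complexD[OF chain_subcomplexD(2)[OF D]]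
  show "comm_group (grp (quotient_complex C D) q)" for q
    using comm_group.abelian_FactGroup[OF C(1) chain_subcomplexD(3)[OF D]] by simp
  show "diff (quotient_complex C D) q \<in> hom (grp (quotient_complex C D) (Suc q)) (grp (quotient_complex C D) q)" for q
    using induced_hom[OF C(1) C(1) C(2) chain_subcomplexD(3)[OF D] chain_subcomplexD(3)[OF D]
        chain_subcomplexD(5)[OF D]] by (simp add: quotient_complex_def)
  fix q X assume "X \<in> carrier (grp (quotient_complex C D) (Suc (Suc q)))"
  then obtain x where x: "x \<in> carrier (grp C (Suc (Suc q)))"
    "X = carrier (grp D (Suc (Suc q))) #>\<^bsub>grp C (Suc (Suc q))\<^esub> x"
    by (auto simp: carrier_FactGroup)
  have dx: "diff C (Suc q) x \<in> carrier (grp C (Suc q))" using hom_in_carrier[OF C(2) x(1)] .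
  interpret G: comm_group "grp C q" by (rule C(1))
  show "diff (quotient_complex C D) q (diff (quotient_complex C D) (Suc q) X) = \<one>\<^bsub>grp (quotient_complex C D) q\<^esub>"
    unfolding x(2) diff_quotient_complex[OF D x(1)] diff_quotient_complex[OF D dx] C(3)[OF x(1)]
    using subgroup.subset[OF chain_subcomplexD(3)[OF D]] by simp
qed

lemma comm_group_sum_group:
  assumes "\<And>i. i \<in> I \<Longrightarrow> comm_group (P i)"
  shows "comm_group (sum_group I P)"
proof -
  have gP: "group (P i)" if "i \<in> I" for i using assms[OF that] by (simp add: comm_group_def)
  interpret group "sum_group I P" by (rule sum_group[OF gP])
  show ?thesis
  proof (rule group_comm_groupI)
    fix x y assume "x \<in> carrier (sum_group I P)" "y \<in> carrier (sum_group I P)"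
    then have xy: "\<And>i. i \<in> I \<Longrightarrow> x i \<in> carrier (P i) \<and> y i \<in> carrier (P i)"
      by (auto simp: carrier_sum_group gP)
    have "x i \<otimes>\<^bsub>P i\<^esub> y i = y i \<otimes>\<^bsub>P i\<^esub> x i" if "i \<in> I" for i
      using xy[OF that] assms[OF that] by (simp add: comm_group_def comm_monoid.m_comm)
    then show "x \<otimes>\<^bsub>sum_group I P\<^esub> y = y \<otimes>\<^bsub>sum_group I P\<^esub> x"
      by (auto intro!: restrict_ext)
  qed
qed

lemma is_chain_complex_direct_sum:
  assumes C: "\<And>i. i \<in> I \<Longrightarrow> is_chain_complex (C i)"
  shows "is_chain_complex (direct_sum_complex I C)"
  unfolding is_chain_complex_def
proof (intro conjI allI ballI)
  note CD = is_chain_complexD[OF C]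
  have g: "group (grp (C i) q)" if "i \<in> I" for i q using CD(1)[OF that] by (simp add: comm_group_def)
  have carr: "carrier (sum_group I (\<lambda>i. grp (C i) q)) =
      {x \<in> \<Pi>\<^sub>E i\<in>I. carrier (grp (C i) q). finite {i \<in> I. x i \<noteq> \<one>\<^bsub>grp (C i) q\<^esub>}}" for q
    by (rule carrier_sum_group) (rule g)
  show "comm_group (grp (direct_sum_complex I C) q)" for q
    using comm_group_sum_group[OF CD(1)] by (simp add: direct_sum_complex_def)
  show "diff (direct_sum_complex I C) q \<in> hom (grp (direct_sum_complex I C) (Suc q)) (grp (direct_sum_complex I C) q)" for q
  proof (rule homI)
    fix x assume "x \<in> carrier (grp (direct_sum_complex I C) (Suc q))"
    then have x: "\<And>i. i \<in> I \<Longrightarrow> x i \<in> carrier (grp (C i) (Suc q))"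
      and xf: "finite {i \<in> I. x i \<noteq> \<one>\<^bsub>grp (C i) (Suc q)\<^esub>}"
      by (auto simp: direct_sum_complex_def carr)
    have "finite {i \<in> I. (\<lambda>i\<in>I. diff (C i) q (x i)) i \<noteq> \<one>\<^bsub>grp (C i) q\<^esub>}"
      by (rule rev_finite_subset[OF xf]) (use hom_one[OF CD(2) g g] in auto)
    then show "diff (direct_sum_complex I C) q x \<in> carrier (grp (direct_sum_complex I C) q)"
      using hom_in_carrier[OF CD(2) x] by (auto simp: direct_sum_complex_def carr)
    fix y assume "y \<in> carrier (grp (direct_sum_complex I C) (Suc q))"
    then have y: "\<And>i. i \<in> I \<Longrightarrow> y i \<in> carrier (grp (C i) (Suc q))"
      by (auto simp: direct_sum_complex_def carr)
    show "diff (direct_sum_complex I C) q (x \<otimes>\<^bsub>grp (direct_sum_complex I C) (Suc q)\<^esub> y) =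
        diff (direct_sum_complex I C) q x \<otimes>\<^bsub>grp (direct_sum_complex I C) q\<^esub> diff (direct_sum_complex I C) q y"
      using hom_mult[OF CD(2) x y] by (auto simp: direct_sum_complex_def intro!: restrict_ext)
  qed
  fix q x assume "x \<in> carrier (grp (direct_sum_complex I C) (Suc (Suc q)))"
  then have x: "\<And>i. i \<in> I \<Longrightarrow> x i \<in> carrier (grp (C i) (Suc (Suc q)))"
    by (auto simp: direct_sum_complex_def carr)
  show "diff (direct_sum_complex I C) q (diff (direct_sum_complex I C) (Suc q) x) = \<one>\<^bsub>grp (direct_sum_complex I C) q\<^esub>"
    using CD(3)[OF _ x] by (auto simp: direct_sum_complex_def intro!: restrict_ext)
qed

text \<open>
  Projections \<open>\<pi> i\<close> from \<open>C\<close> to the \<open>A i\<close>, chosen in each degree separately, split the groups of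
  \<open>C / D\<close>: they induce maps from \<open>C / D\<close> to \<open>A i / B i\<close> that satisfy
  the hypotheses on coordinates in \<open>sum_of_homs_iso\<close>. The isomorphism commutes with the differentials
  because its components are induced by inclusions of complexes.
\<close>

theorem chain_iso_sum_of_inclusions:
  fixes I :: "'i set" and C :: "'a chain_complex"
  assumes D: "chain_subcomplex D C"
    and A: "\<And>i. i \<in> I \<Longrightarrow> chain_subcomplex (A i) C"
    and B: "\<And>i. i \<in> I \<Longrightarrow> chain_subcomplex (B i) (A i)"
    and BD: "\<And>i. i \<in> I \<Longrightarrow> chain_subcomplex (B i) D"
    and \<pi>: "\<And>i q. i \<in> I \<Longrightarrow> \<pi> i q \<in> hom (grp C q) (grp (A i) q)"
    and \<pi>D: "\<And>i q x. i \<in> I \<Longrightarrow> x \<in> carrier (grp D q) \<Longrightarrow> \<pi> i q x \<in> carrier (grp (B i) q)"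
    and diag: "\<And>i q x. i \<in> I \<Longrightarrow> x \<in> carrier (grp (A i) q) \<Longrightarrow>
      carrier (grp (B i) q) #>\<^bsub>grp (A i) q\<^esub> \<pi> i q x = carrier (grp (B i) q) #>\<^bsub>grp (A i) q\<^esub> x"
    and off: "\<And>i j q x. i \<in> I \<Longrightarrow> j \<in> I \<Longrightarrow> i \<noteq> j \<Longrightarrow> x \<in> carrier (grp (A i) q) \<Longrightarrow>
      \<pi> j q x \<in> carrier (grp (B j) q)"
    and fin: "\<And>q x. x \<in> carrier (grp C q) \<Longrightarrow> finite {i \<in> I. \<pi> i q x \<notin> carrier (grp (B i) q)}"
    and ker: "\<And>q x. x \<in> carrier (grp C q) \<Longrightarrow> (\<And>i. i \<in> I \<Longrightarrow> \<pi> i q x \<in> carrier (grp (B i) q)) \<Longrightarrow>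
      x \<in> carrier (grp D q)"
  shows "chain_iso (direct_sum_complex I (\<lambda>i. quotient_complex (A i) (B i)))
    (quotient_complex C D) (sum_of_inclusions I C D)"
  unfolding chain_iso_def
proof (intro conjI allI ballI)
  let ?Q = "quotient_complex C D" and ?P = "\<lambda>i. quotient_complex (A i) (B i)"
  note cC = is_chain_complexD[OF chain_subcomplexD(2)[OF D]]
  note cA = is_chain_complexD[OF chain_subcomplexD(1)[OF A]]
  note cQ = is_chain_complexD[OF is_chain_complex_quotient[OF D]]
  note cP = is_chain_complexD[OF is_chain_complex_quotient[OF B]]
  note sD = chain_subcomplexD(3)[OF D] and sB = chain_subcomplexD(3)[OF B]
  have AC: "x \<in> carrier (grp C q)" if "i \<in> I" "x \<in> carrier (grp (A i) q)" for i q x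
    using subgroup.subset[OF chain_subcomplexD(3)[OF A[OF that(1)]]] that(2) by blast
  have inc: "(\<lambda>x. x) ` carrier (grp (B i) q) \<subseteq> carrier (grp D q)" if "i \<in> I" for i q
    using subgroup.subset[OF chain_subcomplexD(3)[OF BD[OF that]]] by auto
  have pr: "\<pi> i q ` carrier (grp D q) \<subseteq> carrier (grp (B i) q)" if "i \<in> I" for i q
    using \<pi>D[OF that] by blast
  \<comment> \<open>The maps of quotients induced by the inclusions and by the projections.\<close>
  define e where "e i q X = carrier (grp D q) <#>\<^bsub>grp C q\<^esub> X" for i :: 'i and q X
  define \<psi> where "\<psi> i q X = carrier (grp (B i) q) <#>\<^bsub>grp (A i) q\<^esub> \<pi> i q ` X" for i q X
  have e_coset: "e i q (carrier (grp (B i) q) #>\<^bsub>grp (A i) q\<^esub> x) = carrier (grp D q) #>\<^bsub>grp C q\<^esub> x"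
    if "i \<in> I" "x \<in> carrier (grp (A i) q)" for i q x
    using induced_coset[OF cA(1)[OF that(1)] cC(1) chain_subcomplexD(4)[OF A[OF that(1)]] sB[OF that(1)] sD
        inc[OF that(1)] that(2)] by (simp add: e_def)
  have \<psi>_coset: "\<psi> i q (carrier (grp D q) #>\<^bsub>grp C q\<^esub> x) = carrier (grp (B i) q) #>\<^bsub>grp (A i) q\<^esub> \<pi> i q x"
    if "i \<in> I" "x \<in> carrier (grp C q)" for i q x
    unfolding \<psi>_def
    by (rule induced_coset[OF cC(1) cA(1)[OF that(1)] \<pi>[OF that(1)] sD sB[OF that(1)] pr[OF that(1)] that(2)])
  have e_hom: "e i q \<in> hom (grp (?P i) q) (grp ?Q q)" if "i \<in> I" for i q
    using induced_hom[OF cA(1)[OF that(1)] cC(1) chain_subcomplexD(4)[OF A[OF that(1)]] sB[OF that(1)] sD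
        inc[OF that(1)]] by (simp add: e_def[abs_def])
  have \<psi>_hom: "\<psi> i q \<in> hom (grp ?Q q) (grp (?P i) q)" if "i \<in> I" for i q
    using induced_hom[OF cC(1) cA(1)[OF that(1)] \<pi>[OF that(1)] sD sB[OF that(1)] pr[OF that(1)]]
    by (simp add: \<psi>_def[abs_def])
  have coset_one: "carrier (grp (B i) q) #>\<^bsub>grp (A i) q\<^esub> x = carrier (grp (B i) q) \<longleftrightarrow>
      x \<in> carrier (grp (B i) q)" if "i \<in> I" "x \<in> carrier (grp (A i) q)" for i q x
  proof -
    interpret comm_group "grp (A i) q" by (rule cA(1)[OF that(1)])
    show ?thesis
      using coset_join1[OF _ that(2) sB[OF that(1)]] coset_join2[OF that(2) sB[OF that(1)]] by blast
  qed
  have \<pi>A: "\<pi> i q x \<in> carrier (grp (A i) q)" if "i \<in> I" "x \<in> carrier (grp C q)" for i q x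
    using hom_in_carrier[OF \<pi>[OF that(1)] that(2)] .
  have P_coset: "\<exists>x\<in>carrier (grp (A i) q). X = carrier (grp (B i) q) #>\<^bsub>grp (A i) q\<^esub> x"
    if "X \<in> carrier (grp (?P i) q)" for i q X
    using that by (auto simp: carrier_FactGroup)
  have Q_coset: "\<exists>x\<in>carrier (grp C q). X = carrier (grp D q) #>\<^bsub>grp C q\<^esub> x"
    if "X \<in> carrier (grp ?Q q)" for q X
    using that by (auto simp: carrier_FactGroup)
  have sum_eq: "sum_of_inclusions I C D q = (\<lambda>f. gfinprod (grp ?Q q) (\<lambda>i. e i q (f i)) I)" for q
    by (simp add: sum_of_inclusions_def[abs_def] e_def)
  show "is_chain_complex (direct_sum_complex I ?P)"
    by (rule is_chain_complex_direct_sum) (rule is_chain_complex_quotient[OF B])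
  show "is_chain_complex ?Q" by (rule is_chain_complex_quotient[OF D])
  show "sum_of_inclusions I C D q \<in> iso (grp (direct_sum_complex I ?P) q) (grp ?Q q)" for q
  proof -
    have "(\<lambda>f. gfinprod (grp ?Q q) (\<lambda>i. e i q (f i)) I) \<in> iso (sum_group I (\<lambda>i. grp (?P i) q)) (grp ?Q q)"
    proof (rule sum_of_homs_iso[where \<psi> = "\<lambda>i. \<psi> i q"])
      show "comm_group (grp ?Q q)" by (rule cQ(1))
      show "comm_group (grp (?P i) q)" if "i \<in> I" for i by (rule cP(1)[OF that])
      show "e i q \<in> hom (grp (?P i) q) (grp ?Q q)" if "i \<in> I" for i by (rule e_hom[OF that])
      show "\<psi> i q \<in> hom (grp ?Q q) (grp (?P i) q)" if "i \<in> I" for i by (rule \<psi>_hom[OF that])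
      show "\<psi> i q (e i q X) = X" if i: "i \<in> I" and X: "X \<in> carrier (grp (?P i) q)" for i X
      proof -
        obtain x where x: "x \<in> carrier (grp (A i) q)" "X = carrier (grp (B i) q) #>\<^bsub>grp (A i) q\<^esub> x"
          using P_coset[OF X] by blast
        show ?thesis
          unfolding x(2) e_coset[OF i x(1)] \<psi>_coset[OF i AC[OF i x(1)]] by (rule diag[OF i x(1)])
      qed
      show "\<psi> j q (e i q X) = \<one>\<^bsub>grp (?P j) q\<^esub>"
        if i: "i \<in> I" and j: "j \<in> I" and ij: "i \<noteq> j" and X: "X \<in> carrier (grp (?P i) q)" for i j X
      proof -
        obtain x where x: "x \<in> carrier (grp (A i) q)" "X = carrier (grp (B i) q) #>\<^bsub>grp (A i) q\<^esub> x"
          using P_coset[OF X] by blast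
        show ?thesis
          unfolding x(2) e_coset[OF i x(1)] \<psi>_coset[OF j AC[OF i x(1)]]
          using coset_one[OF j \<pi>A[OF j AC[OF i x(1)]]] off[OF i j ij x(1)] by simp
      qed
      fix X assume X: "X \<in> carrier (grp ?Q q)"
      obtain x where x: "x \<in> carrier (grp C q)" "X = carrier (grp D q) #>\<^bsub>grp C q\<^esub> x"
        using Q_coset[OF X] by blast
      have one: "\<psi> i q X = \<one>\<^bsub>grp (?P i) q\<^esub> \<longleftrightarrow> \<pi> i q x \<in> carrier (grp (B i) q)" if "i \<in> I" for i
        unfolding x(2) \<psi>_coset[OF that x(1)] using coset_one[OF that \<pi>A[OF that x(1)]] by simp
      have "{i \<in> I. \<psi> i q X \<noteq> \<one>\<^bsub>grp (?P i) q\<^esub>} = {i \<in> I. \<pi> i q x \<notin> carrier (grp (B i) q)}"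
        using one by blast
      then show "finite {i \<in> I. \<psi> i q X \<noteq> \<one>\<^bsub>grp (?P i) q\<^esub>}" using fin[OF x(1)] by simp
      assume "\<And>i. i \<in> I \<Longrightarrow> \<psi> i q X = \<one>\<^bsub>grp (?P i) q\<^esub>"
      then have "x \<in> carrier (grp D q)" using ker[OF x(1)] one by blast
      interpret comm_group "grp C q" by (rule cC(1))
      show "X = \<one>\<^bsub>grp ?Q q\<^esub>"
        using coset_join2[OF x(1) sD] \<open>x \<in> carrier (grp D q)\<close> by (simp add: x(2))
    qed
    then show ?thesis by (simp add: sum_eq direct_sum_complex_def)
  qed
  fix q f assume f: "f \<in> carrier (grp (direct_sum_complex I ?P) (Suc q))"
  have gP: "group (grp (?P i) q)" if "i \<in> I" for i q using cP(1)[OF that] by (simp add: comm_group_def)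
  interpret Qs: comm_group "grp ?Q (Suc q)" by (rule cQ(1))
  interpret Q: comm_group "grp ?Q q" by (rule cQ(1))
  have fP: "\<And>i. i \<in> I \<Longrightarrow> f i \<in> carrier (grp (?P i) (Suc q))"
    and ff: "finite {i \<in> I. f i \<noteq> \<one>\<^bsub>grp (?P i) (Suc q)\<^esub>}"
    using f by (auto simp: direct_sum_complex_def carrier_sum_group gP simp del: quotient_complex_grp)
  have ef: "(\<lambda>i. e i (Suc q) (f i)) \<in> I \<rightarrow> carrier (grp ?Q (Suc q))"
    using hom_in_carrier[OF e_hom fP] by blast
  have eff: "finite {i \<in> I. e i (Suc q) (f i) \<noteq> \<one>\<^bsub>grp ?Q (Suc q)\<^esub>}"
  proof (rule rev_finite_subset[OF ff], rule subsetI)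
    fix i assume i: "i \<in> {i \<in> I. e i (Suc q) (f i) \<noteq> \<one>\<^bsub>grp ?Q (Suc q)\<^esub>}"
    then have "e i (Suc q) (\<one>\<^bsub>grp (?P i) (Suc q)\<^esub>) = \<one>\<^bsub>grp ?Q (Suc q)\<^esub>"
      using hom_one[OF e_hom gP Qs.is_group] by blast
    then show "i \<in> {i \<in> I. f i \<noteq> \<one>\<^bsub>grp (?P i) (Suc q)\<^esub>}" using i by auto
  qed
  have "diff ?Q q (sum_of_inclusions I C D (Suc q) f) =
      gfinprod (grp ?Q q) (\<lambda>i. diff ?Q q (e i (Suc q) (f i))) I"
    unfolding sum_eq by (rule hom_gfinprod[OF cQ(1) cQ(1) cQ(2) ef eff])
  also have "\<dots> = gfinprod (grp ?Q q) (\<lambda>i. e i q (diff (?P i) q (f i))) I"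
  proof (rule Q.gfinprod_cong)
    show "(\<lambda>i. diff ?Q q (e i (Suc q) (f i))) \<in> I \<rightarrow> carrier (grp ?Q q)"
      using hom_in_carrier[OF cQ(2) hom_in_carrier[OF e_hom fP]] by blast
    fix i
    have "diff ?Q q (e i (Suc q) (f i)) = e i q (diff (?P i) q (f i))" if i: "i \<in> I"
    proof -
      obtain x where x: "x \<in> carrier (grp (A i) (Suc q))"
        "f i = carrier (grp (B i) (Suc q)) #>\<^bsub>grp (A i) (Suc q)\<^esub> x"
        using P_coset[OF fP[OF i]] by blast
      show ?thesis
        using e_coset[OF i hom_in_carrier[OF cA(2)[OF i] x(1)]]
        unfolding x(2) e_coset[OF i x(1)] diff_quotient_complex[OF D AC[OF i x(1)]]
          diff_quotient_complex[OF B[OF i] x(1)] chain_subcomplexD(6)[OF A[OF i] x(1)] by (rule sym)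
    qed
    then show "i \<in> I =simp=> diff ?Q q (e i (Suc q) (f i)) = e i q (diff (?P i) q (f i))"
      by (simp add: simp_implies_def)
  qed simp
  also have "\<dots> = sum_of_inclusions I C D q (diff (direct_sum_complex I ?P) q f)"
    unfolding sum_eq
  proof (rule Q.gfinprod_cong)
    show "(\<lambda>i. e i q (diff (?P i) q (f i))) \<in> I \<rightarrow> carrier (grp ?Q q)"
      using hom_in_carrier[OF e_hom hom_in_carrier[OF cP(2) fP]] by blast
  qed (auto simp: direct_sum_complex_def simp_implies_def)
  finally show "sum_of_inclusions I C D q (diff (direct_sum_complex I ?P) q f) =
      diff ?Q q (sum_of_inclusions I C D (Suc q) f)" ..
qed

section \<open>Chains with prescribed supports\<close>

lemma finite_Cons_support: "finite {w. c w \<noteq> 0} \<Longrightarrow> finite {v. c (v # w) \<noteq> (0::'r::zero)}"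
  using finite_vimageI[of "{w. c w \<noteq> 0}" "\<lambda>v. v # w"] by (auto simp: vimage_def inj_on_def)

lemma chain_bd_eq_sum:
  assumes "w \<noteq> []" "finite A" "{v. c (v # w) \<noteq> 0} \<subseteq> A"
  shows "chain_bd c w = (\<Sum>v\<in>A. c (v # w))"
  unfolding chain_bd_def using assms by (auto intro!: sum.mono_neutral_left)

lemma chain_bd_nonzero:
  assumes "chain_bd c w \<noteq> 0"
  shows "w \<noteq> []" "\<exists>v. c (v # w) \<noteq> 0"
proof -
  show "w \<noteq> []" using assms by (auto simp: chain_bd_def)
  show "\<exists>v. c (v # w) \<noteq> 0"
  proof (rule ccontr)
    assume "\<nexists>v. c (v # w) \<noteq> 0"
    then have "{v. c (v # w) \<noteq> 0} = {}" by blast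
    then show False using assms unfolding chain_bd_def by (metis sum.empty)
  qed
qed

lemma chain_bd_add:
  assumes "finite {w. c w \<noteq> 0}" "finite {w. d w \<noteq> 0}"
  shows "chain_bd (\<lambda>w. c w + d w) w = chain_bd c w + chain_bd d w"
proof (cases "w = []")
  case False
  let ?A = "{v. c (v # w) \<noteq> 0} \<union> {v. d (v # w) \<noteq> 0}"
  have fin: "finite ?A" using assms finite_Cons_support by auto
  have "chain_bd (\<lambda>w. c w + d w) w = (\<Sum>v\<in>?A. c (v # w) + d (v # w))"
    by (rule chain_bd_eq_sum[OF False fin]) auto
  moreover have "chain_bd c w = (\<Sum>v\<in>?A. c (v # w))" "chain_bd d w = (\<Sum>v\<in>?A. d (v # w))"
    by (rule chain_bd_eq_sum[OF False fin]; auto)+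
  ultimately show ?thesis by (simp add: sum.distrib)
qed (simp add: chain_bd_def)

lemma chain_bd_uminus: "chain_bd (\<lambda>w. - c w) w = - chain_bd c w"
  by (simp add: chain_bd_def sum_negf)

lemma chain_bd_zero [simp]: "chain_bd (\<lambda>w. 0) = (\<lambda>w. 0)"
  by (auto simp: chain_bd_def)

lemma oriented_chains_permute:
  assumes "c \<in> oriented_chains K q" "\<pi> permutes {..<length w}"
  shows "c (permute_list \<pi> w) = (if evenperm \<pi> then c w else - c w)"
  using assms by (simp add: oriented_chains_def)

text \<open>
  A permutation of the positions of \<open>w\<close>, shifted to the tail of \<open>v # w\<close>, keeps its sign. So the
  boundary of an alternating function is alternating.
\<close>

lemma permute_list_Cons_shift:
  assumes \<pi>: "\<pi> permutes {..<length w}"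
  obtains \<pi>' where "\<pi>' permutes {..<length (v # w)}" "evenperm \<pi>' \<longleftrightarrow> evenperm \<pi>"
    "permute_list \<pi>' (v # w) = v # permute_list \<pi> w"
proof
  let ?\<pi>' = "map_permutation {..<length w} Suc \<pi>"
  have "bij_betw Suc {..<length w} (Suc ` {..<length w})" by (simp add: bij_betw_def)
  then have p: "?\<pi>' permutes Suc ` {..<length w}"
    using map_permutation_permutes \<pi> by blast
  then show p': "?\<pi>' permutes {..<length (v # w)}"
    by (rule permutes_subset) auto
  show "evenperm ?\<pi>' \<longleftrightarrow> evenperm \<pi>"
    by (rule evenperm_map_permutation[OF _ \<pi>]) auto
  show "permute_list ?\<pi>' (v # w) = v # permute_list \<pi> w"
  proof (rule nth_equalityI)
    fix i assume "i < length (permute_list ?\<pi>' (v # w))"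
    then have i: "i < Suc (length w)" by simp
    show "permute_list ?\<pi>' (v # w) ! i = (v # permute_list \<pi> w) ! i"
    proof (cases i)
      case 0
      have "?\<pi>' 0 = 0" by (rule permutes_not_in[OF p]) auto
      then show ?thesis using permute_list_nth[OF p', of 0] 0 by simp
    next
      case (Suc j)
      have "?\<pi>' (Suc j) = Suc (\<pi> j)"
        using map_permutation_apply[of Suc "{..<length w}" j \<pi>] Suc i by simp
      then show ?thesis using permute_list_nth[OF p', of i] permute_list_nth[OF \<pi>, of j] Suc i by simp
    qed
  qed simp
qed

lemma oriented_chains_swap:
  assumes "c \<in> oriented_chains K q"
  shows "c (u # v # w) = - c (v # u # w)"
proof -
  let ?\<pi> = "Transposition.transpose (0::nat) 1"
  have \<pi>: "?\<pi> permutes {..<length (v # u # w)}" by (rule permutes_swap_id) auto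
  have "permute_list ?\<pi> (v # u # w) = u # v # w"
  proof (rule nth_equalityI)
    fix i assume "i < length (permute_list ?\<pi> (v # u # w))"
    then have i: "i < length (v # u # w)" by simp
    show "permute_list ?\<pi> (v # u # w) ! i = (u # v # w) ! i"
      unfolding permute_list_nth[OF \<pi> i]
      by (cases i) (auto simp: Transposition.transpose_def nth_Cons split: nat.splits)
  qed simp
  then show ?thesis
    using oriented_chains_permute[OF assms \<pi>] by (simp add: evenperm_swap)
qed

lemma oriented_chains_support:
  assumes K: "geom_complex K" and c: "c \<in> oriented_chains K q" and w: "c w \<noteq> 0"
  shows "length w = Suc q" "distinct w" "convex hull (set w) \<in> K" "verts (convex hull (set w)) = set w"
proof -
  obtain \<sigma> where s: "\<sigma> \<in> K" "set w = verts \<sigma>" and "length w = Suc q" "distinct w"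
    using c w by (auto simp: oriented_chains_def)
  then show "length w = Suc q" "distinct w" "convex hull (set w) \<in> K" "verts (convex hull (set w)) = set w"
    using geom_simplex_verts(4)[OF geom_complexD(1)[OF K s(1)]] by auto
qed

lemma oriented_chains_finite: "c \<in> oriented_chains K q \<Longrightarrow> finite {w. c w \<noteq> 0}"
  by (simp add: oriented_chains_def)

lemma oriented_chains_mono: "L \<subseteq> K \<Longrightarrow> oriented_chains L q \<subseteq> oriented_chains K q"
  unfolding oriented_chains_def by blast

text \<open>
  A simplex is determined by its vertices, so a chain lies in a subcomplex as soon as the simplices
  with non-zero coefficient do.
\<close>

lemma oriented_chains_subI:
  assumes K: "geom_complex K" and c: "c \<in> oriented_chains K q"
    and "\<And>w. c w \<noteq> 0 \<Longrightarrow> convex hull (set w) \<in> L"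
  shows "c \<in> oriented_chains L q"
proof -
  have "length w = Suc q \<and> distinct w \<and> (\<exists>\<sigma>\<in>L. set w = verts \<sigma>)" if "c w \<noteq> 0" for w
    using oriented_chains_support[OF K c that] assms(3)[OF that] by metis
  then show ?thesis using c unfolding oriented_chains_def by blast
qed

lemma oriented_chains_zero: "(\<lambda>w. 0) \<in> oriented_chains K q"
  by (simp add: oriented_chains_def)

lemma oriented_chains_uminus: "c \<in> oriented_chains K q \<Longrightarrow> (\<lambda>w. - c w) \<in> oriented_chains K q"
  by (auto simp: oriented_chains_def)

lemma oriented_chains_add:
  assumes c: "c \<in> oriented_chains K q" and d: "d \<in> oriented_chains K q"
  shows "(\<lambda>w. c w + d w) \<in> oriented_chains K q"
proof -
  have "finite {w. c w + d w \<noteq> 0}"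
    by (rule rev_finite_subset[OF finite_UnI[OF oriented_chains_finite[OF c] oriented_chains_finite[OF d]]]) auto
  moreover have "c w \<noteq> 0 \<or> d w \<noteq> 0" if "c w + d w \<noteq> 0" for w using that by auto
  ultimately show ?thesis
    using c d unfolding oriented_chains_def by (simp; blast)
qed

lemma chain_bd_support:
  assumes K: "geom_complex K" and c: "c \<in> oriented_chains K q" and w: "chain_bd c w \<noteq> 0"
  shows "length w = q" "distinct w" "convex hull (set w) \<in> K" "verts (convex hull (set w)) = set w"
proof -
  obtain v where v: "c (v # w) \<noteq> 0" and w0: "w \<noteq> []" using chain_bd_nonzero[OF w] by blast
  note s = oriented_chains_support[OF K c v]
  note gs = geom_complexD(1)[OF K s(3)]
  show "length w = q" "distinct w" using s by auto
  show "convex hull (set w) \<in> K"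
    by (rule subcomplex_hull[OF K subcomplex_refl[OF K] s(3)]) (use s(4) w0 in auto)
  show "verts (convex hull (set w)) = set w"
    by (rule geom_simplex_hull[OF gs]) (use s(4) w0 in auto)
qed

lemma chain_bd_oriented:
  assumes K: "geom_complex K" and c: "c \<in> oriented_chains K (Suc q)"
  shows "chain_bd c \<in> oriented_chains K q"
proof -
  have "length w = Suc q \<and> distinct w \<and> (\<exists>\<sigma>\<in>K. set w = verts \<sigma>)" if "chain_bd c w \<noteq> 0" for w
    using chain_bd_support[OF K c that] by metis
  moreover have "chain_bd c (permute_list \<pi> w) = (if evenperm \<pi> then chain_bd c w else - chain_bd c w)"
    if \<pi>: "\<pi> permutes {..<length w}" for w \<pi>
  proof (cases "w = []")
    case False
    then have pne: "permute_list \<pi> w \<noteq> []" by (metis length_0_conv length_permute_list)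
    have eq: "c (v # permute_list \<pi> w) = (if evenperm \<pi> then c (v # w) else - c (v # w))" for v
    proof -
      obtain \<pi>' where "\<pi>' permutes {..<length (v # w)}" "evenperm \<pi>' \<longleftrightarrow> evenperm \<pi>"
        "permute_list \<pi>' (v # w) = v # permute_list \<pi> w"
        using permute_list_Cons_shift[OF \<pi>] .
      then show ?thesis using oriented_chains_permute[OF c, of \<pi>' "v # w"] by simp
    qed
    show ?thesis
      using False pne by (simp add: chain_bd_def eq sum_negf)
  qed (simp add: chain_bd_def)
  \<comment> \<open>A simplex of the boundary is the tail of an ordered simplex of the chain.\<close>
  moreover have "finite {w. chain_bd c w \<noteq> 0}"
  proof (rule rev_finite_subset[OF finite_imageI[OF oriented_chains_finite[OF c], of tl]])
    show "{w. chain_bd c w \<noteq> 0} \<subseteq> tl ` {w. c w \<noteq> 0}"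
    proof
      fix w assume "w \<in> {w. chain_bd c w \<noteq> 0}"
      then obtain v where "c (v # w) \<noteq> 0" using chain_bd_nonzero(2)[of c w] by blast
      then show "w \<in> tl ` {w. c w \<noteq> 0}" by (intro image_eqI[of _ _ "v # w"]) auto
    qed
  qed
  ultimately show ?thesis unfolding oriented_chains_def by blast
qed

lemma sum_alternating_eq_0:
  fixes g :: "'a \<Rightarrow> 'a \<Rightarrow> 'r::ab_group_add"
  assumes "finite A" "\<And>u v. g u v = - g v u" "\<And>u. g u u = 0"
  shows "(\<Sum>u\<in>A. \<Sum>v\<in>A. g u v) = 0"
  using assms(1)
proof (induction A)
  case (insert a A)
  have "(\<Sum>v\<in>A. g a v) + (\<Sum>u\<in>A. g u a) = (\<Sum>v\<in>A. g a v + g v a)" by (simp add: sum.distrib)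
  also have "\<dots> = 0" using assms(2)[of a] by (intro sum.neutral) auto
  finally have "(\<Sum>u\<in>A. g u a) + (\<Sum>v\<in>A. g a v) = 0" by (simp add: add.commute)
  then show ?case using insert assms(3)[of a] by (simp add: sum.distrib)
qed simp

text \<open>
  The coefficient at \<open>w\<close> is the sum of the coefficients at \<open>v # u # w\<close> over all \<open>u\<close> and \<open>v\<close>, which
  is antisymmetric in \<open>u\<close> and \<open>v\<close>. The diagonal terms vanish because the entries are distinct; antisymmetry
  alone would not give this in the presence of elements of order two.
\<close>

lemma chain_bd_bd:
  assumes K: "geom_complex K" and c: "c \<in> oriented_chains K q"
  shows "chain_bd (chain_bd c) w = 0"
proof (cases "w = []")
  case False
  let ?A = "\<Union>(set ` {w. c w \<noteq> 0})"
  have fin: "finite ?A" using oriented_chains_finite[OF c] by auto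
  have A: "v \<in> ?A" "u \<in> ?A" if "c (v # u # w) \<noteq> 0" for u v
    using that by (auto intro!: bexI[of _ "v # u # w"])
  have 1: "chain_bd c (u # w) = (\<Sum>v\<in>?A. c (v # u # w))" for u
    by (rule chain_bd_eq_sum[OF _ fin]) (use A in auto)
  have "chain_bd (chain_bd c) w = (\<Sum>u\<in>?A. chain_bd c (u # w))"
  proof (rule chain_bd_eq_sum[OF False fin])
    show "{u. chain_bd c (u # w) \<noteq> 0} \<subseteq> ?A"
      using chain_bd_nonzero(2) A(2) by blast
  qed
  also have "\<dots> = (\<Sum>u\<in>?A. \<Sum>v\<in>?A. c (v # u # w))" by (simp only: 1)
  also have "\<dots> = 0"
  proof (rule sum_alternating_eq_0[OF fin])
    show "c (v # u # w) = - c (u # v # w)" for u v by (rule oriented_chains_swap[OF c])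
    show "c (u # u # w) = 0" for u using oriented_chains_support(2)[OF K c, of "u # u # w"] by auto
  qed
  finally show ?thesis .
qed (simp add: chain_bd_def)

text \<open>
  The intersection chains of a filtered complex are the case where \<open>P\<close> is allowability. Keeping \<open>P\<close>
  abstract separates the algebra of chains from strata and perversities.
\<close>

definition supported_chains where
  "supported_chains K P q = {c \<in> oriented_chains K q.
     \<forall>w. c w \<noteq> 0 \<or> chain_bd c w \<noteq> 0 \<longrightarrow> P (convex hull (set w))}"

definition supported_complex ::
  "'v::real_vector set set \<Rightarrow> ('v set \<Rightarrow> bool) \<Rightarrow> ('v list \<Rightarrow> 'r::ab_group_add) chain_complex" where
  "supported_complex K P =
     \<lparr>grp = (\<lambda>q. \<lparr>carrier = supported_chains K P q, monoid.mult = (\<lambda>c c' w. c w + c' w), one = (\<lambda>w. 0)\<rparr>),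
      diff = (\<lambda>q. chain_bd)\<rparr>"

lemma supported_complex_simps [simp]:
  "carrier (grp (supported_complex K P) q) = supported_chains K P q"
  "c \<otimes>\<^bsub>grp (supported_complex K P) q\<^esub> c' = (\<lambda>w. c w + c' w)"
  "\<one>\<^bsub>grp (supported_complex K P) q\<^esub> = (\<lambda>w. 0)"
  "diff (supported_complex K P) q = chain_bd"
  by (simp_all add: supported_complex_def)

lemma supported_chains_add:
  assumes c: "c \<in> supported_chains K P q" and d: "d \<in> supported_chains K P q"
  shows "(\<lambda>w. c w + d w) \<in> supported_chains K P q"
proof -
  have o: "c \<in> oriented_chains K q" "d \<in> oriented_chains K q" using c d by (auto simp: supported_chains_def)
  have "P (convex hull (set w))" if "c w + d w \<noteq> 0 \<or> chain_bd c w + chain_bd d w \<noteq> 0" for w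
  proof -
    have "c w \<noteq> 0 \<or> d w \<noteq> 0 \<or> chain_bd c w \<noteq> 0 \<or> chain_bd d w \<noteq> 0" using that by auto
    then show ?thesis using c d unfolding supported_chains_def by blast
  qed
  then show ?thesis
    using oriented_chains_add[OF o] chain_bd_add[OF oriented_chains_finite[OF o(1)] oriented_chains_finite[OF o(2)]]
    unfolding supported_chains_def by simp
qed

lemma supported_chains_uminus:
  assumes c: "c \<in> supported_chains K P q"
  shows "(\<lambda>w. - c w) \<in> supported_chains K P q"
  using assms oriented_chains_uminus[of c K q] by (simp add: supported_chains_def chain_bd_uminus)

lemma supported_chains_zero [simp]: "(\<lambda>w. 0) \<in> supported_chains K P q"
  by (simp add: supported_chains_def oriented_chains_zero)

lemma comm_group_supported: "comm_group (grp (supported_complex K P) q)"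
proof (rule comm_groupI)
  fix c assume "c \<in> carrier (grp (supported_complex K P) q)"
  then show "\<exists>d\<in>carrier (grp (supported_complex K P) q).
      d \<otimes>\<^bsub>grp (supported_complex K P) q\<^esub> c = \<one>\<^bsub>grp (supported_complex K P) q\<^esub>"
    using supported_chains_uminus by (intro bexI[of _ "\<lambda>w. - c w"]) auto
qed (auto simp: supported_chains_add add.assoc add.commute)

lemma is_chain_complex_supported:
  fixes K :: "'v::real_vector set set"
  assumes K: "geom_complex K"
  shows "is_chain_complex (supported_complex K P :: ('v list \<Rightarrow> 'r::ab_group_add) chain_complex)"
    (is "is_chain_complex ?C")
  unfolding is_chain_complex_def
proof (intro conjI allI ballI)
  show "comm_group (grp ?C q)" for q by (rule comm_group_supported)
  have bdbd: "chain_bd (chain_bd c) = (\<lambda>w. 0)" if "c \<in> supported_chains K P q" for c :: "'v list \<Rightarrow> 'r" and q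
    using chain_bd_bd[OF K, of c q] that by (auto simp: supported_chains_def)
  show "diff ?C q \<in> hom (grp ?C (Suc q)) (grp ?C q)" for q
  proof (rule homI)
    fix c assume "c \<in> carrier (grp ?C (Suc q))"
    then have c: "c \<in> supported_chains K P (Suc q)" by simp
    then have co: "c \<in> oriented_chains K (Suc q)" by (simp add: supported_chains_def)
    show "diff ?C q c \<in> carrier (grp ?C q)"
      using c chain_bd_oriented[OF K co] bdbd[OF c] by (simp add: supported_chains_def)
    fix d assume "d \<in> carrier (grp ?C (Suc q))"
    then have do: "d \<in> oriented_chains K (Suc q)" by (simp add: supported_chains_def)
    show "diff ?C q (c \<otimes>\<^bsub>grp ?C (Suc q)\<^esub> d) =
      diff ?C q c \<otimes>\<^bsub>grp ?C q\<^esub> diff ?C q d"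
      using chain_bd_add[OF oriented_chains_finite[OF co] oriented_chains_finite[OF do]] by auto
  qed
  fix q c assume "c \<in> carrier (grp ?C (Suc (Suc q)))"
  then show "diff ?C q (diff ?C (Suc q) c) = \<one>\<^bsub>grp ?C q\<^esub>"
    using bdbd by simp
qed

lemma supported_chains_mono: "L \<subseteq> K \<Longrightarrow> supported_chains L P q \<subseteq> supported_chains K P q"
  using oriented_chains_mono[of L K q] by (auto simp: supported_chains_def)

lemma supported_chains_subI:
  assumes "geom_complex K" "c \<in> supported_chains K P q"
    "\<And>w. c w \<noteq> 0 \<Longrightarrow> convex hull (set w) \<in> L"
  shows "c \<in> supported_chains L P q"
  using assms oriented_chains_subI[of K c q L] by (auto simp: supported_chains_def)

lemma chain_subcomplex_supported:
  fixes K L :: "'v::real_vector set set"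
  assumes "geom_complex K" "geom_complex L" "L \<subseteq> K"
  shows "chain_subcomplex (supported_complex L P)
    (supported_complex K P :: ('v list \<Rightarrow> 'r::ab_group_add) chain_complex)" (is "chain_subcomplex ?D ?C")
  unfolding chain_subcomplex_def
proof (intro conjI allI ballI)
  fix q
  interpret comm_group "grp ?C q" by (rule comm_group_supported)
  show "subgroup (carrier (grp ?D q)) (grp ?C q)"
  proof (rule subgroupI)
    show "carrier (grp ?D q) \<noteq> {}"
      using supported_chains_zero[of L P q] by (metis empty_iff supported_complex_simps(1))
    fix c assume c: "c \<in> carrier (grp ?D q)"
    have "inv\<^bsub>grp ?C q\<^esub> c = (\<lambda>w. - c w)"
      using c supported_chains_mono[OF assms(3), of P q] supported_chains_uminus[of c]
      by (intro inv_equality) auto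
    then show "inv\<^bsub>grp ?C q\<^esub> c \<in> carrier (grp ?D q)"
      using c supported_chains_uminus by simp
  qed (use supported_chains_mono[OF assms(3), of P q] supported_chains_add in auto)
qed (auto simp: is_chain_complex_supported assms)

lemma supported_chains_cong:
  assumes K: "geom_complex K" and P: "\<And>\<sigma>. \<sigma> \<in> K \<Longrightarrow> P \<sigma> \<longleftrightarrow> P' \<sigma>"
  shows "supported_chains K P q = supported_chains K P' q"
proof -
  have "P (convex hull (set w)) \<longleftrightarrow> P' (convex hull (set w))"
    if "c \<in> oriented_chains K q" "c w \<noteq> 0 \<or> chain_bd c w \<noteq> 0" for c :: "'a list \<Rightarrow> 'b" and w
    using P oriented_chains_support(3)[OF K that(1)] chain_bd_support(3)[OF K that(1)] that(2) by blast
  then show ?thesis unfolding supported_chains_def by blast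
qed

lemma supported_complex_cong:
  fixes K :: "'v::real_vector set set"
  assumes K: "geom_complex K" and P: "\<And>\<sigma>. \<sigma> \<in> K \<Longrightarrow> P \<sigma> \<longleftrightarrow> P' \<sigma>"
  shows "(supported_complex K P :: ('v list \<Rightarrow> 'r::ab_group_add) chain_complex) = supported_complex K P'"
proof -
  have "(supported_chains K P q :: ('v list \<Rightarrow> 'r) set) = supported_chains K P' q" for q
    by (rule supported_chains_cong[OF K P])
  then show ?thesis by (simp add: supported_complex_def)
qed

definition restrict_chain :: "'v set \<Rightarrow> ('v list \<Rightarrow> 'r) \<Rightarrow> 'v list \<Rightarrow> 'r::zero" where
  "restrict_chain A c = (\<lambda>w. if A \<subseteq> set w then c w else 0)"

lemma restrict_chain_oriented:
  assumes c: "c \<in> oriented_chains K q"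
  shows "restrict_chain A c \<in> oriented_chains K q"
proof -
  have "finite {w. restrict_chain A c w \<noteq> 0}"
    by (rule rev_finite_subset[OF oriented_chains_finite[OF c]]) (auto simp: restrict_chain_def)
  then show ?thesis
    using c unfolding oriented_chains_def restrict_chain_def by auto
qed

text \<open>
  All simplices that contribute to the boundary at a simplex containing \<open>A\<close> contain \<open>A\<close> themselves,
  and so survive the restriction.
\<close>

lemma chain_bd_restrict:
  assumes "A \<subseteq> set w"
  shows "chain_bd (restrict_chain A c) w = chain_bd c w"
proof -
  have "restrict_chain A c (v # w) = c (v # w)" for v
    using assms by (auto simp: restrict_chain_def)
  then show ?thesis by (simp add: chain_bd_def)
qed

text \<open>
  A simplex of the boundary of the restricted chain either contains \<open>A\<close>, and then has the same
  coefficient in the boundary of \<open>c\<close>, or it arises from a simplex of \<open>c\<close> containing \<open>A\<close> by removing a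
  vertex in \<open>A\<close>, where the hypothesis on \<open>P\<close> applies.
\<close>

lemma restrict_chain_supported:
  assumes K: "geom_complex K" and c: "c \<in> supported_chains K P q"
    and P: "\<And>\<sigma> v. \<sigma> \<in> K \<Longrightarrow> P \<sigma> \<Longrightarrow> A \<subseteq> verts \<sigma> \<Longrightarrow> v \<in> A \<Longrightarrow> verts \<sigma> - {v} \<noteq> {} \<Longrightarrow>
      P (convex hull (verts \<sigma> - {v}))"
  shows "restrict_chain A c \<in> supported_chains K P q"
proof -
  have co: "c \<in> oriented_chains K q" using c by (simp add: supported_chains_def)
  have "P (convex hull (set w))" if r: "restrict_chain A c w \<noteq> 0" for w
  proof -
    have "c w \<noteq> 0" using r by (auto simp: restrict_chain_def split: if_splits)
    then show ?thesis using c by (simp add: supported_chains_def)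
  qed
  moreover have "P (convex hull (set w))" if bd: "chain_bd (restrict_chain A c) w \<noteq> 0" for w
  proof (cases "A \<subseteq> set w")
    case True
    then show ?thesis using bd c by (simp add: chain_bd_restrict supported_chains_def)
  next
    case False
    obtain v where v: "restrict_chain A c (v # w) \<noteq> 0" and w: "w \<noteq> []"
      using chain_bd_nonzero[OF bd] by blast
    then have cv: "c (v # w) \<noteq> 0" and A: "A \<subseteq> set (v # w)"
      by (auto simp: restrict_chain_def split: if_splits)
    have vA: "v \<in> A" using A False by auto
    let ?s = "convex hull (set (v # w))"
    note s = oriented_chains_support[OF K co cv]
    have sw: "verts ?s - {v} = set w" using s(2,4) by auto
    have "P ?s" using cv c unfolding supported_chains_def by blast
    from P[OF s(3) this _ vA, unfolded sw] show ?thesis using A s(4) w by simp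
  qed
  ultimately show ?thesis
    using restrict_chain_oriented[OF co] by (auto simp: supported_chains_def)
qed

section \<open>Splitting relative chains along the clots\<close>

lemma intersection_complex_eq_supported:
  "intersection_complex F n p = supported_complex (F n) (allowable F n p)"
  by (simp add: intersection_complex_def supported_complex_def intersection_chains_def supported_chains_def)

lemma (in full_filtered_complex) sub_intersection_complex_eq_supported:
  assumes L: "subcomplex L K"
  shows "sub_intersection_complex F n p L = supported_complex L (allowable F n p)"
proof -
  have "induced_filtration F L n = L"
    using subcomplexD(1)[OF L] by (auto simp: induced_filtration_def)
  then show ?thesis
    unfolding sub_intersection_complex_def intersection_complex_eq_supported
    by (simp only:)
      (rule supported_complex_cong[OF geom_complex_subcomplex[OF complex L] induced_allowable_iff[OF L]])
qed

context nonempty_full_filtered_complex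
begin

abbreviation "clot_star \<beta> \<equiv> closed_star K \<beta>"
abbreviation "clot_star_boundary \<beta> \<equiv> {\<sigma> \<in> closed_star K \<beta>. \<not> verts \<beta> \<subseteq> verts \<sigma>}"

text \<open>
  A simplex of \<open>\<partial>\<beta> * L\<^sub>\<beta>\<close> is a face of a simplex that contains \<open>\<beta>\<close>, so it can contain no other
  clot, and it does not contain \<open>\<beta>\<close>.
\<close>

lemma clot_star_boundary_subset_residual:
  assumes b: "\<beta> \<in> clots F n"
  shows "clot_star_boundary \<beta> \<subseteq> residual F n"
proof
  fix \<sigma> assume "\<sigma> \<in> clot_star_boundary \<beta>"
  then obtain \<rho> where s: "\<sigma> \<in> K" "\<not> verts \<beta> \<subseteq> verts \<sigma>" and r: "\<rho> \<in> K" "verts \<beta> \<union> verts \<sigma> \<subseteq> verts \<rho>"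
    by (auto simp: closed_star_def)
  have "\<beta>' = \<beta>" if "\<beta>' \<in> clots F n" "verts \<beta>' \<subseteq> verts \<sigma>" for \<beta>'
    by (rule clot_unique[OF r(1) that(1) _ b]) (use that r in auto)
  then show "\<sigma> \<in> residual F n" using mem_residual_iff[OF s(1)] s(2) by blast
qed

lemma restrict_clot_supported:
  assumes b: "\<beta> \<in> clots F n" and c: "c \<in> supported_chains K (allowable F n p) q"
  shows "restrict_chain (verts \<beta>) c \<in> supported_chains (clot_star \<beta>) (allowable F n p) q"
proof (rule supported_chains_subI[OF complex])
  show "restrict_chain (verts \<beta>) c \<in> supported_chains K (allowable F n p) q"
    by (rule restrict_chain_supported[OF complex c])
      (rule allowable_remove_clot_vertex[OF _ _ b], auto)
  fix w assume "restrict_chain (verts \<beta>) c w \<noteq> 0"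
  then have w: "c w \<noteq> 0" "verts \<beta> \<subseteq> set w" by (auto simp: restrict_chain_def split: if_splits)
  have "c \<in> oriented_chains K q" using c by (simp add: supported_chains_def)
  note oriented_chains_support[OF complex this w(1)]
  then show "convex hull (set w) \<in> clot_star \<beta>" using w(2) by (auto simp: closed_star_def)
qed

text \<open>
  The projection to the summand of \<open>\<beta>\<close> keeps the coefficients of the simplices that contain \<open>\<beta>\<close>.
  It vanishes on chains of the residual complex and on the summands of other clots, it changes chains
  of \<open>\<beta> * L\<^sub>\<beta>\<close> by chains of \<open>\<partial>\<beta> * L\<^sub>\<beta>\<close> only, and a chain killed by all projections involves no
  simplex outside the residual complex.
  
  The families \<open>J\<close> and \<open>J'\<close> are prescribed on clots only, since the description of the joins as parts
  of the closed star is valid for \<open>\<beta> \<in> K\<close>.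
\<close>

lemma chain_iso_clots:
  fixes p :: "'a set \<Rightarrow> ereal"
  defines "al \<equiv> allowable F n p"
  defines "CK \<equiv> supported_complex K al :: ('a list \<Rightarrow> 'r::ab_group_add) chain_complex"
  defines "CL \<equiv> supported_complex (residual F n) al :: ('a list \<Rightarrow> 'r) chain_complex"
  assumes J_def: "\<And>\<beta>. \<beta> \<in> clots F n \<Longrightarrow> J \<beta> = supported_complex (clot_star \<beta>) al"
    and J'_def: "\<And>\<beta>. \<beta> \<in> clots F n \<Longrightarrow> J' \<beta> = supported_complex (clot_star_boundary \<beta>) al"
  shows "chain_subcomplex CL CK"
    and "\<beta> \<in> clots F n \<Longrightarrow> chain_subcomplex (J' \<beta>) (J \<beta>)"
    and "\<beta> \<in> clots F n \<Longrightarrow> chain_subcomplex (J \<beta>) CK"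
    and "\<beta> \<in> clots F n \<Longrightarrow> chain_subcomplex (J' \<beta>) CL"
    and "chain_iso (direct_sum_complex (clots F n) (\<lambda>\<beta>. quotient_complex (J \<beta>) (J' \<beta>)))
      (quotient_complex CK CL) (sum_of_inclusions (clots F n) CK CL)"
proof -
  note star = subcomplex_closed_star(1)[OF complex]
  note bdry = subcomplex_closed_star(2)[OF complex]
  note g = geom_complex_subcomplex[OF complex]
  note gr = g[OF subcomplex_residual] and gs = g[OF star] and gb = g[OF bdry]
  show CL: "chain_subcomplex CL CK"
    unfolding CL_def CK_def
    by (rule chain_subcomplex_supported[OF complex gr subcomplexD(1)[OF subcomplex_residual]])
  show J: "chain_subcomplex (J \<beta>) CK" if "\<beta> \<in> clots F n" for \<beta>
    unfolding J_def[OF that] CK_def by (rule chain_subcomplex_supported[OF complex gs subcomplexD(1)[OF star]])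
  show J': "chain_subcomplex (J' \<beta>) (J \<beta>)" if "\<beta> \<in> clots F n" for \<beta>
    unfolding J_def[OF that] J'_def[OF that] by (rule chain_subcomplex_supported[OF gs gb]) auto
  show J'L: "chain_subcomplex (J' \<beta>) CL" if "\<beta> \<in> clots F n" for \<beta>
    unfolding J'_def[OF that] CL_def
    by (rule chain_subcomplex_supported[OF gr gb clot_star_boundary_subset_residual[OF that]])
  let ?\<pi> = "\<lambda>\<beta> q. restrict_chain (verts \<beta>) :: ('a list \<Rightarrow> 'r) \<Rightarrow> _"
  have orient: "c \<in> oriented_chains L q" if "c \<in> supported_chains L al q" for c :: "'a list \<Rightarrow> 'r" and L q
    using that by (simp add: supported_chains_def)
  have zero: "?\<pi> \<beta> q c = (\<lambda>w. 0)" if "\<And>w. c w \<noteq> 0 \<Longrightarrow> \<not> verts \<beta> \<subseteq> set w" for \<beta> c and q :: nat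
  proof
    show "?\<pi> \<beta> q c w = 0" for w using that[of w] by (auto simp: restrict_chain_def)
  qed
  show "chain_iso (direct_sum_complex (clots F n) (\<lambda>\<beta>. quotient_complex (J \<beta>) (J' \<beta>)))
      (quotient_complex CK CL) (sum_of_inclusions (clots F n) CK CL)"
  proof (rule chain_iso_sum_of_inclusions[OF CL J J' J'L, where \<pi> = ?\<pi>])
    fix \<beta> q assume b: "\<beta> \<in> clots F n"
    show "?\<pi> \<beta> q \<in> hom (grp CK q) (grp (J \<beta>) q)"
    proof (rule homI)
      fix c assume "c \<in> carrier (grp CK q)"
      then show "?\<pi> \<beta> q c \<in> carrier (grp (J \<beta>) q)"
        using restrict_clot_supported[OF b] by (simp add: CK_def J_def[OF b] al_def)
    qed (auto simp: CK_def J_def[OF b] restrict_chain_def)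
    show "?\<pi> \<beta> q c \<in> carrier (grp (J' \<beta>) q)" if "c \<in> carrier (grp CL q)" for c
    proof -
      have c: "c \<in> supported_chains (residual F n) al q" using that by (simp add: CL_def)
      have "\<not> verts \<beta> \<subseteq> set w" if "c w \<noteq> 0" for w
      proof -
        note w = oriented_chains_support[OF gr orient[OF c] that]
        then show ?thesis
          using mem_residual_iff[of "convex hull (set w)"] subcomplexD(1)[OF subcomplex_residual] b by auto
      qed
      then have "?\<pi> \<beta> q c = (\<lambda>w. 0)" by (rule zero)
      then show ?thesis by (simp add: J'_def[OF b])
    qed
    show "carrier (grp (J' \<beta>) q) #>\<^bsub>grp (J \<beta>) q\<^esub> ?\<pi> \<beta> q c = carrier (grp (J' \<beta>) q) #>\<^bsub>grp (J \<beta>) q\<^esub> c"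
      if "c \<in> carrier (grp (J \<beta>) q)" for c
    proof -
      have c: "c \<in> supported_chains (clot_star \<beta>) al q" using that by (simp add: J_def[OF b])
      interpret comm_group "grp (J \<beta>) q" unfolding J_def[OF b] by (rule comm_group_supported)
      have cK: "c \<in> supported_chains K al q"
        using c supported_chains_mono[OF subcomplexD(1)[OF star]] by blast
      have \<pi>c: "?\<pi> \<beta> q c \<in> supported_chains (clot_star \<beta>) al q"
        using restrict_clot_supported[OF b] cK by (simp add: al_def)
      \<comment> \<open>The difference of a chain and its projection has no simplex containing \<open>\<beta>\<close>.\<close>
      let ?d = "\<lambda>w. ?\<pi> \<beta> q c w + - c w"
      have d: "?d \<in> supported_chains (clot_star \<beta>) al q"
        by (rule supported_chains_add[OF \<pi>c supported_chains_uminus[OF c]])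
      have "?d \<in> supported_chains (clot_star_boundary \<beta>) al q"
      proof (rule supported_chains_subI[OF gs d])
        fix w assume w: "?d w \<noteq> 0"
        then have "\<not> verts \<beta> \<subseteq> set w" by (auto simp: restrict_chain_def)
        then show "convex hull (set w) \<in> clot_star_boundary \<beta>"
          using oriented_chains_support(3,4)[OF gs orient[OF d] w] by simp
      qed
      then have "?\<pi> \<beta> q c \<in> carrier (grp (J' \<beta>) q) #>\<^bsub>grp (J \<beta>) q\<^esub> c"
        unfolding r_coset_def by (auto simp: J_def[OF b] J'_def[OF b] intro!: bexI[of _ ?d])
      then show ?thesis
        using repr_independence[OF _ that chain_subcomplexD(3)[OF J'[OF b]]] by simp
    qed
  next
    fix \<beta> \<gamma> q c assume b: "\<beta> \<in> clots F n" "\<gamma> \<in> clots F n" "\<beta> \<noteq> \<gamma>" and "c \<in> carrier (grp (J \<beta>) q)"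
    then have c: "c \<in> supported_chains (clot_star \<beta>) al q" by (simp add: J_def)
    have "\<not> verts \<gamma> \<subseteq> set w" if w: "c w \<noteq> 0" for w
    proof
      assume sub: "verts \<gamma> \<subseteq> set w"
      obtain \<rho> where r: "\<rho> \<in> K" "verts \<beta> \<union> set w \<subseteq> verts \<rho>"
        using oriented_chains_support(3,4)[OF gs orient[OF c] w] by (auto simp: closed_star_def)
      have "\<beta> = \<gamma>" by (rule clot_unique[OF r(1) b(1) _ b(2)]) (use r sub in auto)
      then show False using b(3) by blast
    qed
    then have "?\<pi> \<gamma> q c = (\<lambda>w. 0)" by (rule zero)
    then show "?\<pi> \<gamma> q c \<in> carrier (grp (J' \<gamma>) q)" by (simp add: J'_def[OF b(2)])
  next
    fix q c assume "c \<in> carrier (grp CK q)"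
    then have c: "c \<in> supported_chains K al q" by (simp add: CK_def)
    note co = orient[OF c]
    \<comment> \<open>Each of the finitely many simplices of \<open>c\<close> contains at most one clot.\<close>
    let ?S = "\<Union>w\<in>{w. c w \<noteq> 0}. {\<beta> \<in> clots F n. verts \<beta> \<subseteq> set w}"
    have "finite {\<beta> \<in> clots F n. verts \<beta> \<subseteq> set w}" if w: "c w \<noteq> 0" for w
    proof -
      note s = oriented_chains_support(3,4)[OF complex co w]
      have "\<beta> = \<gamma>" if "\<beta> \<in> clots F n" "verts \<beta> \<subseteq> set w" "\<gamma> \<in> clots F n" "verts \<gamma> \<subseteq> set w" for \<beta> \<gamma>
        by (rule clot_unique[OF s(1) that(1) _ that(3)]) (use that s(2) in auto)
      then have "{\<beta> \<in> clots F n. verts \<beta> \<subseteq> set w} \<subseteq> {SOME \<beta>. \<beta> \<in> clots F n \<and> verts \<beta> \<subseteq> set w}"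
        by (smt (verit, best) mem_Collect_eq singletonI someI_ex subsetI)
      then show ?thesis by (rule finite_subset) simp
    qed
    then have "finite ?S" using oriented_chains_finite[OF co] by blast
    moreover have "{\<beta> \<in> clots F n. ?\<pi> \<beta> q c \<notin> carrier (grp (J' \<beta>) q)} \<subseteq> ?S"
    proof
      fix \<beta> assume \<beta>: "\<beta> \<in> {\<beta> \<in> clots F n. ?\<pi> \<beta> q c \<notin> carrier (grp (J' \<beta>) q)}"
      then have "?\<pi> \<beta> q c \<noteq> (\<lambda>w. 0)" by (auto simp: J'_def)
      then obtain w where "c w \<noteq> 0" "verts \<beta> \<subseteq> set w" using zero[of c \<beta>] by blast
      then show "\<beta> \<in> ?S" using \<beta> by blast
    qed
    ultimately show "finite {\<beta> \<in> clots F n. ?\<pi> \<beta> q c \<notin> carrier (grp (J' \<beta>) q)}"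
      by (rule rev_finite_subset)
    assume \<pi>: "\<And>\<beta>. \<beta> \<in> clots F n \<Longrightarrow> ?\<pi> \<beta> q c \<in> carrier (grp (J' \<beta>) q)"
    have "c \<in> supported_chains (residual F n) al q"
    proof (rule supported_chains_subI[OF complex c])
      fix w assume w: "c w \<noteq> 0"
      note s = oriented_chains_support(3,4)[OF complex co w]
      have "\<not> verts \<beta> \<subseteq> set w" if b: "\<beta> \<in> clots F n" for \<beta>
      proof
        assume sub: "verts \<beta> \<subseteq> set w"
        then have "?\<pi> \<beta> q c w \<noteq> 0" using w by (simp add: restrict_chain_def)
        moreover have "?\<pi> \<beta> q c \<in> supported_chains (clot_star_boundary \<beta>) al q"
          using \<pi>[OF b] by (simp add: J'_def[OF b])
        ultimately have "convex hull (set w) \<in> clot_star_boundary \<beta>"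
          using oriented_chains_support(3)[OF gb orient] by blast
        then show False using sub s(2) by simp
      qed
      then show "convex hull (set w) \<in> residual F n" using mem_residual_iff[OF s(1)] s(2) by simp
    qed
    then show "c \<in> carrier (grp CL q)" by (simp add: CL_def)
  qed
qed

end

theorem proposition2p3:
  fixes F :: "nat \<Rightarrow> 'v::real_normed_vector set set"
    and n :: nat
    and p :: "'v set \<Rightarrow> ereal"
  assumes "filtered_complex F n"
    and "full_filtration F n"
    and "perversity F n p"
    and "F n \<noteq> {}"
  shows "let B = clots F n;
             CK = (intersection_complex F n p :: ('v list \<Rightarrow> 'r::ab_group_add) chain_complex);
             CL = sub_intersection_complex F n p (residual F n);
             J = (\<lambda>\<beta>. sub_intersection_complex F n p
                        (complex_join (faces \<beta>) (link (F n) \<beta>)));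
             J' = (\<lambda>\<beta>. sub_intersection_complex F n p
                        (complex_join (boundary_complex \<beta>) (link (F n) \<beta>)))
         in chain_subcomplex CL CK \<and>
            (\<forall>\<beta>\<in>B. chain_subcomplex (J' \<beta>) (J \<beta>) \<and>
                     chain_subcomplex (J \<beta>) CK \<and> chain_subcomplex (J' \<beta>) CL) \<and>
            chain_iso (direct_sum_complex B (\<lambda>\<beta>. quotient_complex (J \<beta>) (J' \<beta>)))
                      (quotient_complex CK CL)
                      (sum_of_inclusions B CK CL)"
proof -
  interpret nonempty_full_filtered_complex F n
    by unfold_locales (use assms in auto)
  note star = subcomplex_closed_star[OF complex]
  have J: "sub_intersection_complex F n p (complex_join (faces \<beta>) (link (F n) \<beta>)) =
      (supported_complex (clot_star \<beta>) (allowable F n p) :: ('v list \<Rightarrow> 'r) chain_complex)"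
    and J': "sub_intersection_complex F n p (complex_join (boundary_complex \<beta>) (link (F n) \<beta>)) =
      (supported_complex (clot_star_boundary \<beta>) (allowable F n p) :: ('v list \<Rightarrow> 'r) chain_complex)"
    if "\<beta> \<in> clots F n" for \<beta>
    unfolding complex_join_faces_link[OF complex clotsD(2)[OF that]]
      complex_join_boundary_link[OF complex clotsD(2)[OF that]]
    by (rule sub_intersection_complex_eq_supported[OF star(1)])
      (rule sub_intersection_complex_eq_supported[OF star(2)])
  note CL = sub_intersection_complex_eq_supported[OF subcomplex_residual, of p]
  note main = chain_iso_clots[of _ p, OF J J']
  show ?thesis
    unfolding Let_def intersection_complex_eq_supported CL
    by (intro conjI ballI main)
qed

end
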